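(* Let $(\mathcal{X},\delta)$ be a metric space, let $P\subseteq\mathcal{X}$ be a set of $n\ge 2$ points whose minimum pairwise distance is $1$ and whose doubling dimension $d$ is $O(1)$, let $\Delta=\max_{x,y\in P}\delta(x,y)$, let $\tau$ be a real number with $1\le\tau\le\Delta$, let $\alpha>1$, and let $G$ be the $\alpha$-convergent graph of $P$ (defined in the context). Consider any query point $q\in\mathcal{X}$ whose exact nearest neighbor in $P$ is $v^*$. (1) If $\delta(q,v^* )\le\tau$, greedy routing on $G$ can find $v^*$ in $O((\alpha\tau)^d\log\Delta\,\log_\alpha\Delta)$ time. (2) Otherwise, greedy routing on $G$ can find an $\left(\frac{\alpha+1}{\alpha-1}+\epsilon\right)$-approximate nearest neighbor of $q$ in $O\!\left((\alpha\tau)^d\log\Delta\,\log_\alpha\frac{\Delta}{(\alpha-1)\epsilon}\right)$ time, for any $\epsilon>0$. Moreover, $G$ has space $O(n(\alpha\tau)^d\log\Delta)$ and can be constructed in $O(n^2((\alpha\tau)^d\log\Delta+\log n))$ time.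
   Context: A point $v^*\in P$ is an (exact) nearest neighbor of $q$ if $\delta(v^*,q)\le\delta(p,q)$ for all $p\in P$; for $c>1$, a point $p\in P$ is a $c$-approximate nearest neighbor of $q$ if $\delta(p,q)\le c\,\delta(p',q)$ for all $p'\in P$. The doubling constant of a finite set $D$ is the smallest $\lambda$ such that for every $p\in D$ and $r>0$, $D\cap B(p,r)$ can be covered by at most $\lambda$ balls of radius $r/2$, where $B(p,r)=\{x\in\mathcal{X}:\delta(p,x)\le r\}$; the doubling dimension is $\log_2\lambda$. The $\alpha$-convergent graph $G$ of $P$ (with parameters $\alpha$ and $\tau$) is the directed graph with vertex set $P$ in which the out-neighbors of each $p\in P$ are computed as follows: sort $P\setminus\{p\}$ in ascending order of distance to $p$; start with $S=\emptyset$; for each $u$ in this order, if there exists $v\in S$ with $\delta(p,u)>\alpha\,\delta(u,v)+(\alpha+1)\tau$ then skip $u$, otherwise add $u$ to $S$; the final $S$ is the out-neighbor set of $p$. Greedy routing on $G$ from an entry vertex $s$: maintain a current (hop) vertex, initially $s$; compute the distances to $q$ of all its out-neighbors; if some out-neighbor is closer to $q$ than the current vertex, move to the out-neighbor closest to $q$, otherwise stop and return the current vertex. Each distance computation takes constant time, so the query time is the total out-degree of the visited hop vertices. The constants hidden in $O(\cdot)$ may depend on $d$.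
   Formalization: log Δ, log_α Δ use max(2,Δ), and the log in (2) is at least 1, since literal bounds vanish at Δ=1 or large ε; doubling balls are centred in the set (else false); (2) counts time until an approximate neighbor is visited; the constant is chosen per type of points (nat suffices). *)

theory Defs
  imports "HOL-Analysis.Abstract_Metric_Spaces" "HOL-Library.Monad_Syntax"
begin

text \<open>Doubling dimension.  The covering balls are centred at points of \<open>D\<close>, i.e. \<open>D\<close> is treated as
  a metric space in its own right.  Allowing centres in the whole of \<open>M\<close> would give a star (leaves
  at mutual distance 1, hub at distance 1/2 outside \<open>D\<close>) doubling constant 1, whatever
  the number of leaves.\<close>

context Metric_space
begin

definition doubling_constant :: "'a set \<Rightarrow> nat" where
  "doubling_constant D =
     (LEAST l. \<forall>p\<in>D. \<forall>r>0. \<exists>C\<subseteq>D. finite C \<and> card C \<le> l \<and> D \<inter> mcball p r \<subseteq> (\<Union>c\<in>C. mcball c (r / 2)))"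

definition doubling_dimension :: "'a set \<Rightarrow> real" where
  "doubling_dimension D = log 2 (real (doubling_constant D))"

end

definition nearest_neighbor :: "('a \<Rightarrow> 'a \<Rightarrow> real) \<Rightarrow> 'a set \<Rightarrow> 'a \<Rightarrow> 'a \<Rightarrow> bool" where
  "nearest_neighbor \<delta> P q v \<longleftrightarrow> v \<in> P \<and> (\<forall>p\<in>P. \<delta> v q \<le> \<delta> p q)"

definition approx_nearest_neighbor :: "('a \<Rightarrow> 'a \<Rightarrow> real) \<Rightarrow> 'a set \<Rightarrow> real \<Rightarrow> 'a \<Rightarrow> 'a \<Rightarrow> bool" where
  "approx_nearest_neighbor \<delta> P c q p \<longleftrightarrow> p \<in> P \<and> (\<forall>p'\<in>P. \<delta> p q \<le> c * \<delta> p' q)"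

text \<open>Directed graphs on \<open>P\<close> are edge relations \<open>E \<subseteq> P \<times> P\<close>; the out-neighbours of \<open>p\<close> are \<open>E `` {p}\<close>.
  The order in which equidistant points are processed is left open, so a point set may have
  several \<open>\<alpha>\<close>-convergent graphs.\<close>

fun select :: "('a \<Rightarrow> 'a \<Rightarrow> real) \<Rightarrow> real \<Rightarrow> real \<Rightarrow> 'a \<Rightarrow> 'a set \<Rightarrow> 'a list \<Rightarrow> 'a set" where
  "select \<delta> \<alpha> \<tau> p S [] = S"
| "select \<delta> \<alpha> \<tau> p S (u # us) =
     (if \<exists>v\<in>S. \<delta> p u > \<alpha> * \<delta> u v + (\<alpha> + 1) * \<tau> then select \<delta> \<alpha> \<tau> p S us
      else select \<delta> \<alpha> \<tau> p (insert u S) us)"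

definition convergent_graph ::
    "('a \<Rightarrow> 'a \<Rightarrow> real) \<Rightarrow> real \<Rightarrow> real \<Rightarrow> 'a set \<Rightarrow> ('a \<times> 'a) set \<Rightarrow> bool" where
  "convergent_graph \<delta> \<alpha> \<tau> P E \<longleftrightarrow> E \<subseteq> P \<times> P \<and>
     (\<forall>p\<in>P. \<exists>us. distinct us \<and> set us = P - {p} \<and> sorted_wrt (\<lambda>u v. \<delta> p u \<le> \<delta> p v) us \<and>
        E `` {p} = select \<delta> \<alpha> \<tau> p {} us)"

text \<open>Greedy routing.  If several out-neighbours are closest to \<open>q\<close>, any of them may be taken.
  A run is the list of its hop vertices, including the entry vertex and the returned vertex.\<close>

definition greedy_step :: "('a \<Rightarrow> 'a \<Rightarrow> real) \<Rightarrow> ('a \<times> 'a) set \<Rightarrow> 'a \<Rightarrow> 'a \<Rightarrow> 'a \<Rightarrow> bool" where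
  "greedy_step \<delta> E q p p' \<longleftrightarrow>
     is_arg_min (\<lambda>u. \<delta> u q) (\<lambda>u. u \<in> E `` {p}) p' \<and> \<delta> p' q < \<delta> p q"

definition greedy_run :: "('a \<Rightarrow> 'a \<Rightarrow> real) \<Rightarrow> ('a \<times> 'a) set \<Rightarrow> 'a \<Rightarrow> 'a \<Rightarrow> 'a list \<Rightarrow> bool" where
  "greedy_run \<delta> E q s hs \<longleftrightarrow> hs \<noteq> [] \<and> hd hs = s \<and> successively (greedy_step \<delta> E q) hs \<and>
     \<not> (\<exists>u \<in> E `` {last hs}. \<delta> u q < \<delta> (last hs) q)"

definition query_time :: "('a \<times> 'a) set \<Rightarrow> 'a list \<Rightarrow> nat" where
  "query_time E hs = (\<Sum>p\<leftarrow>hs. card (E `` {p}))"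

definition graph_space :: "'a set \<Rightarrow> ('a \<times> 'a) set \<Rightarrow> nat" where
  "graph_space P E = card P + card E"

text \<open>Construction time is measured in a step-counting monad.  Every recursive call below is
  charged one step and does, besides calls that are charged themselves, at most one distance
  computation and a constant number of comparisons, arithmetic operations and list-cell accesses.\<close>

datatype 'b tm = TM (val: 'b) (steps: nat)

definition ret :: "'b \<Rightarrow> 'b tm" where
  "ret x = TM x 0"

definition tick :: "unit tm" where
  "tick = TM () 1"

definition bind_tm :: "'b tm \<Rightarrow> ('b \<Rightarrow> 'c tm) \<Rightarrow> 'c tm" where
  "bind_tm m f = TM (val (f (val m))) (steps m + steps (f (val m)))"

adhoc_overloading Monad_Syntax.bind \<rightleftharpoons> bind_tm

lemma bind_tm_cong [fundef_cong]:
  "m = m' \<Longrightarrow> (\<And>x. x = val m' \<Longrightarrow> f x = g x) \<Longrightarrow> bind_tm m f = bind_tm m' g"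
  by (simp add: bind_tm_def)

lemma val_steps_simps [simp]:
  "val (ret x) = x" "steps (ret x) = 0" "steps tick = 1"
  "val (bind_tm m f) = val (f (val m))"
  "steps (bind_tm m f) = steps m + steps (f (val m))"
  by (simp_all add: ret_def tick_def bind_tm_def)

fun halve :: "'b list \<Rightarrow> ('b list \<times> 'b list) tm" where
  "halve [] = do { tick; ret ([], []) }"
| "halve [x] = do { tick; ret ([x], []) }"
| "halve (x # y # zs) = do { tick; (xs, ys) \<leftarrow> halve zs; ret (x # xs, y # ys) }"

fun merge :: "(real \<times> 'a) list \<Rightarrow> (real \<times> 'a) list \<Rightarrow> (real \<times> 'a) list tm" where
  "merge [] ys = do { tick; ret ys }"
| "merge (x # xs) [] = do { tick; ret (x # xs) }"
| "merge (x # xs) (y # ys) =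
     (if fst x \<le> fst y then do { tick; zs \<leftarrow> merge xs (y # ys); ret (x # zs) }
      else do { tick; zs \<leftarrow> merge (x # xs) ys; ret (y # zs) })"

lemma length_halve:
  "length (fst (val (halve zs))) \<le> length zs \<and> length (snd (val (halve zs))) \<le> length zs"
  by (induction zs rule: halve.induct) (auto split: prod.splits)

function msort :: "(real \<times> 'a) list \<Rightarrow> (real \<times> 'a) list tm" where
  "msort [] = do { tick; ret [] }"
| "msort [x] = do { tick; ret [x] }"
| "msort (x # y # zs) = do { tick; (us, vs) \<leftarrow> halve (x # y # zs);
     us' \<leftarrow> msort us; vs' \<leftarrow> msort vs; merge us' vs' }"
  by pat_completeness auto
termination
proof (relation "Wellfounded.measure length", goal_cases)
  case (2 x y zs _ p us vs)
  then show ?case using length_halve[of zs] by (auto split: prod.splits)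
next
  case (3 x y zs _ p us vs)
  then show ?case using length_halve[of zs] by (auto split: prod.splits)
qed simp

fun with_distances :: "('a \<Rightarrow> 'a \<Rightarrow> real) \<Rightarrow> 'a \<Rightarrow> 'a list \<Rightarrow> (real \<times> 'a) list tm" where
  "with_distances \<delta> p [] = do { tick; ret [] }"
| "with_distances \<delta> p (u # us) = do { tick; rs \<leftarrow> with_distances \<delta> p us;
     ret (if u = p then rs else (\<delta> p u, u) # rs) }"

fun blocked :: "('a \<Rightarrow> 'a \<Rightarrow> real) \<Rightarrow> real \<Rightarrow> real \<Rightarrow> real \<Rightarrow> 'a \<Rightarrow> 'a list \<Rightarrow> bool tm" where
  "blocked \<delta> \<alpha> \<tau> r u [] = do { tick; ret False }"
| "blocked \<delta> \<alpha> \<tau> r u (v # vs) =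
     (if r > \<alpha> * \<delta> u v + (\<alpha> + 1) * \<tau> then do { tick; ret True }
      else do { tick; blocked \<delta> \<alpha> \<tau> r u vs })"

fun prune :: "('a \<Rightarrow> 'a \<Rightarrow> real) \<Rightarrow> real \<Rightarrow> real \<Rightarrow> 'a list \<Rightarrow> (real \<times> 'a) list \<Rightarrow> 'a list tm" where
  "prune \<delta> \<alpha> \<tau> vs [] = do { tick; ret vs }"
| "prune \<delta> \<alpha> \<tau> vs ((r, u) # rs) = do { tick; b \<leftarrow> blocked \<delta> \<alpha> \<tau> r u vs;
     prune \<delta> \<alpha> \<tau> (if b then vs else u # vs) rs }"

definition out_list :: "('a \<Rightarrow> 'a \<Rightarrow> real) \<Rightarrow> real \<Rightarrow> real \<Rightarrow> 'a list \<Rightarrow> 'a \<Rightarrow> 'a list tm" where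
  "out_list \<delta> \<alpha> \<tau> ps p =
     do { tick; rs \<leftarrow> with_distances \<delta> p ps; rs' \<leftarrow> msort rs; prune \<delta> \<alpha> \<tau> [] rs' }"

fun build_from ::
    "('a \<Rightarrow> 'a \<Rightarrow> real) \<Rightarrow> real \<Rightarrow> real \<Rightarrow> 'a list \<Rightarrow> 'a list \<Rightarrow> ('a \<times> 'a list) list tm" where
  "build_from \<delta> \<alpha> \<tau> ps [] = do { tick; ret [] }"
| "build_from \<delta> \<alpha> \<tau> ps (p # rest) = do { tick; us \<leftarrow> out_list \<delta> \<alpha> \<tau> ps p;
     adj \<leftarrow> build_from \<delta> \<alpha> \<tau> ps rest; ret ((p, us) # adj) }"

definition build_graph ::
    "('a \<Rightarrow> 'a \<Rightarrow> real) \<Rightarrow> real \<Rightarrow> real \<Rightarrow> 'a list \<Rightarrow> ('a \<times> 'a list) list tm" where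
  "build_graph \<delta> \<alpha> \<tau> ps = build_from \<delta> \<alpha> \<tau> ps ps"

definition edges_of :: "('a \<times> 'a list) list \<Rightarrow> ('a \<times> 'a) set" where
  "edges_of adj = {(p, u). \<exists>us. (p, us) \<in> set adj \<and> u \<in> set us}"

text \<open>The logarithms inside the O-bounds are kept away from 0, as any nonzero cost
  requires: in \<open>log \<Delta>\<close> and \<open>log\<^sub>\<alpha> \<Delta>\<close> the argument is \<open>max 2 \<Delta>\<close>, hence \<open>\<Delta>\<close> itself as soon as \<open>\<Delta> \<ge> 2\<close>, and
  \<open>log\<^sub>\<alpha> (\<Delta> / ((\<alpha> - 1) * \<epsilon>))\<close>, which is negative for large \<open>\<epsilon>\<close>, is replaced by 1 when it is below 1.\<close>

definition degree_bound :: "real \<Rightarrow> real \<Rightarrow> real \<Rightarrow> real \<Rightarrow> real" where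
  "degree_bound d \<alpha> \<tau> \<Delta> = (\<alpha> * \<tau>) powr d * log 2 (max 2 \<Delta>)"

end

theory Submission
  imports Defs "HOL-Library.Multiset"
begin

text \<open>
  Two out-neighbours \<open>u\<close>, \<open>v\<close> of \<open>p\<close> with \<open>\<delta> p u > 2 (\<alpha> + 1) \<tau>\<close> are at distance at least
  \<open>\<delta> p u / (2 \<alpha>)\<close>, and all others lie in one ball of radius \<open>O(\<alpha> \<tau>)\<close> in which points have distance
  at least 1.  Packing in this ball and in each of the \<open>O(log \<Delta>)\<close> dyadic rings around it bounds
  the out-degree.  If the current hop vertex \<open>p\<close> has no edge to the nearest neighbour \<open>v\<close>, the
  out-neighbour that caused \<open>v\<close> to be skipped lies at distance less than
  \<open>\<delta> p q / \<alpha> + (\<alpha> + 1) / \<alpha> * (\<delta> v q - \<tau>)\<close> from \<open>q\<close>, so the distance to \<open>q\<close> contracts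
  geometrically towards \<open>(\<alpha> + 1) / (\<alpha> - 1) * (\<delta> v q - \<tau>)\<close>, which is not positive when
  \<open>\<delta> v q \<le> \<tau>\<close>.  In that case an inexact vertex without an edge to \<open>v\<close> is farther than \<open>\<alpha> \<tau>\<close>
  from \<open>q\<close>, which limits the number of hops.
\<close>

section \<open>Packing in doubling point sets\<close>

text \<open>Minimum distance 1 is split into its two uses. Separation drives every packing bound,
  and a pair attaining distance 1 forces the doubling constant to be at least 2, so that
  \<open>dim\<close> is at least 1 and powers with exponent \<open>dim\<close> dominate their base
  when it is at least 1.\<close>

locale doubling_points = Metric_space M \<delta> for M :: "'a set" and \<delta> +
  fixes P :: "'a set"
  assumes P_sub: "P \<subseteq> M" and finite_P: "finite P"
    and separated: "\<And>x y. x \<in> P \<Longrightarrow> y \<in> P \<Longrightarrow> x \<noteq> y \<Longrightarrow> 1 \<le> \<delta> x y"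
    and closest_pair: "\<exists>x\<in>P. \<exists>y\<in>P. \<delta> x y = 1"
begin

abbreviation dim :: real where
  "dim \<equiv> doubling_dimension P"

text \<open>The \<open>LEAST\<close> in the definition is attained because some bound exists: the
  finite set \<open>P\<close>, taken as its own set of centres, covers every ball.\<close>

lemma doubling_cover:
  assumes "p \<in> P" "r > 0"
  shows "\<exists>C\<subseteq>P. finite C \<and> card C \<le> doubling_constant P \<and>
           P \<inter> mcball p r \<subseteq> (\<Union>c\<in>C. mcball c (r / 2))"
proof -
  have "\<forall>p\<in>P. \<forall>r>0. \<exists>C\<subseteq>P. finite C \<and> card C \<le> card P \<and> P \<inter> mcball p r \<subseteq> (\<Union>c\<in>C. mcball c (r / 2))"
    using finite_P P_sub by (intro ballI allI impI exI[of _ P]) auto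
  then have "\<forall>p\<in>P. \<forall>r>0. \<exists>C\<subseteq>P. finite C \<and> card C \<le> doubling_constant P \<and>
      P \<inter> mcball p r \<subseteq> (\<Union>c\<in>C. mcball c (r / 2))"
    unfolding doubling_constant_def by (rule LeastI)
  with assms show ?thesis by blast
qed

lemma doubling_cover_iterated:
  assumes "p \<in> P" "r > 0"
  shows "\<exists>C\<subseteq>P. finite C \<and> card C \<le> doubling_constant P ^ k \<and>
           P \<inter> mcball p r \<subseteq> (\<Union>c\<in>C. mcball c (r / 2 ^ k))"
proof (induction k)
  case 0
  then show ?case using assms by (intro exI[of _ "{p}"]) auto
next
  case (Suc k)
  then obtain C where C: "C \<subseteq> P" "finite C" "card C \<le> doubling_constant P ^ k"
    "P \<inter> mcball p r \<subseteq> (\<Union>c\<in>C. mcball c (r / 2 ^ k))" by blast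
  have "\<forall>c\<in>C. \<exists>B\<subseteq>P. finite B \<and> card B \<le> doubling_constant P \<and>
          P \<inter> mcball c (r / 2 ^ k) \<subseteq> (\<Union>b\<in>B. mcball b (r / 2 ^ k / 2))"
    using C(1) assms by (intro ballI doubling_cover) auto
  then obtain B where B: "\<And>c. c \<in> C \<Longrightarrow> B c \<subseteq> P \<and> finite (B c) \<and> card (B c) \<le> doubling_constant P \<and>
          P \<inter> mcball c (r / 2 ^ k) \<subseteq> (\<Union>b\<in>B c. mcball b (r / 2 ^ k / 2))"
    by metis
  have "card (\<Union>c\<in>C. B c) \<le> (\<Sum>c\<in>C. card (B c))"
    by (rule card_UN_le[OF C(2)])
  also have "\<dots> \<le> (\<Sum>c\<in>C. doubling_constant P)"
    using B by (intro sum_mono) auto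
  also have "\<dots> \<le> doubling_constant P ^ Suc k"
    using C(3) by simp
  finally have "card (\<Union>c\<in>C. B c) \<le> doubling_constant P ^ Suc k" .
  moreover have "P \<inter> mcball p r \<subseteq> (\<Union>b\<in>(\<Union>c\<in>C. B c). mcball b (r / 2 ^ Suc k))"
  proof
    fix x assume x: "x \<in> P \<inter> mcball p r"
    then obtain c where c: "c \<in> C" "x \<in> mcball c (r / 2 ^ k)" using C(4) by blast
    then have "x \<in> (\<Union>b\<in>B c. mcball b (r / 2 ^ k / 2))" using B[of c] x by blast
    then show "x \<in> (\<Union>b\<in>(\<Union>c\<in>C. B c). mcball b (r / 2 ^ Suc k))" using c(1) by (auto simp: field_simps)
  qed
  moreover have "(\<Union>c\<in>C. B c) \<subseteq> P" "finite (\<Union>c\<in>C. B c)" using B C(2) by auto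
  ultimately show ?case by blast
qed

text \<open>Pigeonhole on a \<open>k\<close>-fold refined cover: two points in the same covering
  ball would be at distance at most \<open>2 * r / 2 ^ k\<close>, which is below the separation
  \<open>s\<close>. So sending each point to the centre of a ball containing it is
  injective.\<close>

lemma card_packing_le_power:
  assumes "p \<in> P" "r > 0" "S \<subseteq> P \<inter> mcball p r"
    and sep: "\<And>x y. x \<in> S \<Longrightarrow> y \<in> S \<Longrightarrow> x \<noteq> y \<Longrightarrow> s \<le> \<delta> x y"
    and k: "2 * r < 2 ^ k * s"
  shows "card S \<le> doubling_constant P ^ k"
proof -
  obtain C where C: "C \<subseteq> P" "finite C" "card C \<le> doubling_constant P ^ k"
    "P \<inter> mcball p r \<subseteq> (\<Union>c\<in>C. mcball c (r / 2 ^ k))"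
    using doubling_cover_iterated[OF assms(1,2), of k] by (elim exE conjE)
  have "\<forall>x\<in>S. \<exists>c\<in>C. x \<in> mcball c (r / 2 ^ k)" using C(4) assms(3) by blast
  then obtain f where f: "\<And>x. x \<in> S \<Longrightarrow> f x \<in> C \<and> x \<in> mcball (f x) (r / 2 ^ k)" by metis
  have "inj_on f S"
  proof (rule inj_onI, rule ccontr)
    fix x y assume xy: "x \<in> S" "y \<in> S" "f x = f y" "x \<noteq> y"
    have "\<delta> x y \<le> \<delta> x (f x) + \<delta> (f x) y" using f[OF xy(1)] f[OF xy(2)] by (intro triangle) auto
    also have "\<dots> \<le> r / 2 ^ k + r / 2 ^ k"
      using f[OF xy(1)] f[OF xy(2)] xy(3) by (intro add_mono) (auto simp: commute)
    also have "\<dots> < s" using k by (simp add: field_simps)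
    finally show False using sep[OF xy(1,2,4)] by simp
  qed
  then have "card S \<le> card C" using f C(2) by (intro card_inj_on_le[of f]) auto
  with C(3) show ?thesis by simp
qed

text \<open>The unit ball around one end of a closest pair contains both ends, while a ball of
  radius 1/2 centred in \<open>P\<close> contains no point of \<open>P\<close> except its centre.
  Each end therefore needs its own covering ball.\<close>

lemma doubling_constant_ge_2: "doubling_constant P \<ge> 2"
proof -
  obtain x y where xy: "x \<in> P" "y \<in> P" "\<delta> x y = 1" using closest_pair by blast
  then have ne: "x \<noteq> y" using P_sub by auto
  obtain C where C: "C \<subseteq> P" "finite C" "card C \<le> doubling_constant P"
    "P \<inter> mcball x 1 \<subseteq> (\<Union>c\<in>C. mcball c (1 / 2))"
    using doubling_cover[OF xy(1), of 1] by auto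
  have self: "c = z" if "z \<in> P" "c \<in> C" "z \<in> mcball c (1 / 2)" for z c
    using separated[of c z] that C(1) by force
  have "x \<in> P \<inter> mcball x 1" "y \<in> P \<inter> mcball x 1" using xy P_sub by auto
  then have "{x, y} \<subseteq> C" using C(4) self by blast
  then have "card {x, y} \<le> card C" using C(2) by (rule card_mono[rotated])
  with ne C(3) show ?thesis by simp
qed

lemma dim_ge_1: "dim \<ge> 1"
  using doubling_constant_ge_2 unfolding doubling_dimension_def by simp

lemma card_packing_le_powr:
  assumes "p \<in> P" "S \<subseteq> P \<inter> mcball p r" "0 < s" "s \<le> r"
    and sep: "\<And>x y. x \<in> S \<Longrightarrow> y \<in> S \<Longrightarrow> x \<noteq> y \<Longrightarrow> s \<le> \<delta> x y"
  shows "real (card S) \<le> (4 * r / s) powr dim"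
proof -
  \<comment> \<open>The least natural number strictly above the logarithm, since the pigeonhole
    argument needs a strict inequality. Rounding up costs at most a factor 2, which turns
    \<open>2 * r / s\<close> into \<open>4 * r / s\<close>.\<close>
  define k where "k = Suc (nat \<lfloor>log 2 (2 * r / s)\<rfloor>)"
  have pos: "2 * r / s \<ge> 1" using assms(3,4) by (simp add: field_simps)
  then have "log 2 (2 * r / s) \<ge> 0" by simp
  then have k: "log 2 (2 * r / s) < real k" "real k \<le> log 2 (2 * r / s) + 1"
    unfolding k_def by linarith+
  have "2 * r / s < 2 powr real k" using k(1) pos by (simp add: log_less_iff)
  then have "2 * r < 2 ^ k * s" using assms(3) by (simp add: powr_realpow field_simps)
  then have "card S \<le> doubling_constant P ^ k"
    using assms by (intro card_packing_le_power[OF assms(1) _ assms(2) sep]) auto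
  then have "real (card S) \<le> real (doubling_constant P) ^ k"
    using of_nat_mono by fastforce
  also have "real (doubling_constant P) = 2 powr dim"
    using doubling_constant_ge_2 unfolding doubling_dimension_def by simp
  also have "(2 powr dim) ^ k = (2 powr real k) powr dim"
    by (simp add: powr_powr mult.commute flip: powr_realpow)
  also have "\<dots> \<le> (2 powr (log 2 (2 * r / s) + 1)) powr dim"
    using k(2) dim_ge_1 by (intro powr_mono2) auto
  also have "2 powr (log 2 (2 * r / s) + 1) = 4 * r / s"
    using pos assms(3,4) by (simp add: powr_add)
  finally show ?thesis .
qed

text \<open>\<open>P\<close> is itself a 1-separated set inside a ball of radius
  \<open>\<Delta>\<close>. The resulting degree bound does not involve \<alpha>, which is what very
  large \<alpha> calls for.\<close>

lemma card_P_le: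
  assumes "\<And>x y. x \<in> P \<Longrightarrow> y \<in> P \<Longrightarrow> \<delta> x y \<le> \<Delta>" "1 \<le> \<Delta>"
  shows "real (card P) \<le> (4 * \<Delta>) powr dim"
proof -
  obtain p where p: "p \<in> P" using closest_pair by blast
  have "real (card P) \<le> (4 * \<Delta> / 1) powr dim"
    using assms p P_sub separated by (intro card_packing_le_powr[OF p]) auto
  then show ?thesis by simp
qed

end

section \<open>Out-degrees of convergent graphs\<close>

lemma select_superset: "S \<subseteq> select \<delta> \<alpha> \<tau> p S us"
  by (induction us arbitrary: S) (auto, blast)

lemma select_subset: "select \<delta> \<alpha> \<tau> p S us \<subseteq> S \<union> set us"
proof (induction us arbitrary: S)
  case (Cons u us)
  show ?case using Cons[of S] Cons[of "insert u S"] by auto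
qed simp

text \<open>The point that blocks \<open>u\<close> belongs to the accumulator when \<open>u\<close>
  is examined, and the accumulator only grows, so the blocker is still there at the end.\<close>

lemma select_skipped:
  assumes "u \<in> set us" "u \<notin> select \<delta> \<alpha> \<tau> p S us"
  shows "\<exists>v \<in> select \<delta> \<alpha> \<tau> p S us. \<delta> p u > \<alpha> * \<delta> u v + (\<alpha> + 1) * \<tau>"
  using assms
proof (induction us arbitrary: S)
  case (Cons w us)
  show ?case
  proof (cases "u = w")
    case True
    then show ?thesis
      using Cons.prems select_superset[of S \<delta> \<alpha> \<tau> p us] select_superset[of "insert w S" \<delta> \<alpha> \<tau> p us]
      by (auto split: if_splits)
  next
    case False
    then show ?thesis using Cons by (auto split: if_splits)
  qed
qed simp

text \<open>An order-free form of what the selection guarantees: the inequality is required for both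
  orientations of each pair, so the packing argument can forget the processing order.\<close>

definition spaced :: "('a \<Rightarrow> 'a \<Rightarrow> real) \<Rightarrow> real \<Rightarrow> real \<Rightarrow> 'a \<Rightarrow> 'a set \<Rightarrow> bool" where
  "spaced \<delta> \<alpha> \<tau> p A \<longleftrightarrow> (\<forall>u\<in>A. \<forall>v\<in>A. u \<noteq> v \<longrightarrow> \<delta> p u \<le> \<alpha> * \<delta> u v + (\<alpha> + 1) * \<tau>)"

text \<open>On insertion \<open>u\<close> has just been tested against all of \<open>S\<close>,
  which gives one orientation. The other follows because earlier points are no farther from
  \<open>p\<close> than \<open>u\<close> and the distance is symmetric.\<close>

lemma spaced_select:
  assumes "spaced \<delta> \<alpha> \<tau> p S" "sorted_wrt (\<lambda>u v. \<delta> p u \<le> \<delta> p v) us"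
    and "\<And>v u. v \<in> S \<Longrightarrow> u \<in> set us \<Longrightarrow> \<delta> p v \<le> \<delta> p u"
    and comm: "\<And>x y. \<delta> x y = \<delta> y x"
  shows "spaced \<delta> \<alpha> \<tau> p (select \<delta> \<alpha> \<tau> p S us)"
  using assms(1-3)
proof (induction us arbitrary: S)
  case (Cons u us)
  show ?case
  proof (cases "\<exists>v\<in>S. \<delta> p u > \<alpha> * \<delta> u v + (\<alpha> + 1) * \<tau>")
    case True
    then show ?thesis using Cons by simp
  next
    case False
    have "spaced \<delta> \<alpha> \<tau> p (insert u S)"
    proof -
      have "\<delta> p u \<le> \<alpha> * \<delta> u v + (\<alpha> + 1) * \<tau>" if "v \<in> S" for v
        using False that by force
      moreover from this have "\<delta> p v \<le> \<alpha> * \<delta> v u + (\<alpha> + 1) * \<tau>" if "v \<in> S" for v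
        using that Cons.prems(3)[OF that, of u] comm[of u v] by fastforce
      ultimately show ?thesis using Cons.prems(1) unfolding spaced_def by blast
    qed
    then have "spaced \<delta> \<alpha> \<tau> p (select \<delta> \<alpha> \<tau> p (insert u S) us)"
      using Cons.prems by (intro Cons.IH) auto
    then show ?thesis by (simp only: select.simps False if_False)
  qed
qed simp

lemma degree_bound_ge_1:
  assumes "1 < \<alpha>" "1 \<le> \<tau>" "0 \<le> D"
  shows "1 \<le> degree_bound D \<alpha> \<tau> \<Delta>"
proof -
  have "1 * 1 \<le> \<alpha> * \<tau>" using assms by (intro mult_mono) auto
  then have "1 * 1 \<le> (\<alpha> * \<tau>) powr D * log 2 (max 2 \<Delta>)"
    using assms by (intro mult_mono) (auto simp: ge_one_powr_ge_zero)
  then show ?thesis unfolding degree_bound_def by simp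
qed

section \<open>Out-degree bound by decomposition into dyadic rings\<close>

locale convergent_params = doubling_points +
  fixes \<Delta> \<tau> \<alpha> :: real
  assumes diam: "\<And>x y. x \<in> P \<Longrightarrow> y \<in> P \<Longrightarrow> \<delta> x y \<le> \<Delta>"
    and \<tau>_ge_1: "1 \<le> \<tau>" and \<tau>_le: "\<tau> \<le> \<Delta>" and \<alpha>_gt_1: "1 < \<alpha>"
begin

text \<open>From radius \<open>R\<close> on, the additive term of \<open>spaced\<close> is at most
  half the distance to \<open>p\<close>, so the separation inside a ring grows with its radius and
  each ring holds \<open>O(\<alpha> powr dim)\<close> points. Inside radius \<open>R\<close> only
  unit separation is available, which is where \<tau> enters the bound.\<close>

lemma card_spaced_le:
  assumes p: "p \<in> P" and A: "A \<subseteq> P" and sp: "spaced \<delta> \<alpha> \<tau> p A"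
  shows "real (card A) \<le> 3 * 16 powr dim * degree_bound dim \<alpha> \<tau> \<Delta>"
proof -
  define R where "R = 2 * (\<alpha> + 1) * \<tau>"
  define A0 where "A0 = {u \<in> A. \<delta> p u \<le> R}"
  define ring where "ring i = {u \<in> A. R * 2 ^ i < \<delta> p u \<and> \<delta> p u \<le> R * 2 ^ Suc i}" for i :: nat
  define m where "m = nat \<lceil>log 2 \<Delta>\<rceil>"
  \<comment> \<open>The 16 covers both ratios passed to the packing bound: \<open>4 * R\<close> is
    at most \<open>16 * (\<alpha> * \<tau>)\<close> for the inner ball, and each ring gives exactly
    \<open>16 * \<alpha>\<close>.\<close>
  define K where "K = 16 powr dim * (\<alpha> * \<tau>) powr dim"
  have \<Delta>1: "1 \<le> \<Delta>" using \<tau>_ge_1 \<tau>_le by simp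
  have "2 * 2 * 1 \<le> R" unfolding R_def using \<alpha>_gt_1 \<tau>_ge_1 by (intro mult_mono) auto
  then have R: "4 \<le> R" by simp
  have R_half: "R / 2 = (\<alpha> + 1) * \<tau>" unfolding R_def by simp
  have \<alpha>\<tau>: "\<alpha> \<le> \<alpha> * \<tau>" using \<alpha>_gt_1 \<tau>_ge_1 by simp
  have finA: "finite A" using A finite_P by (rule finite_subset)
  have in_M: "x \<in> P \<Longrightarrow> x \<in> M" for x using P_sub by auto
  have K: "x powr dim \<le> K" if "0 \<le> x" "x \<le> 16 * (\<alpha> * \<tau>)" for x
  proof -
    have "x powr dim \<le> (16 * (\<alpha> * \<tau>)) powr dim"
      using that dim_ge_1 by (intro powr_mono2) auto
    also have "\<dots> = K" unfolding K_def using \<alpha>_gt_1 \<tau>_ge_1 by (simp add: powr_mult)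
    finally show ?thesis .
  qed
  have "real (card A0) \<le> (4 * R / 1) powr dim"
    using A p R in_M unfolding A0_def
    by (intro card_packing_le_powr[OF p]) (auto intro!: separated)
  also have "\<dots> \<le> K"
  proof (rule K)
    have "\<alpha> * \<tau> + \<tau> \<le> 2 * (\<alpha> * \<tau>)" using \<alpha>_gt_1 \<tau>_ge_1 by simp
    then show "4 * R / 1 \<le> 16 * (\<alpha> * \<tau>)" unfolding R_def by (simp add: algebra_simps)
  qed (use R in simp)
  finally have cA0: "real (card A0) \<le> K" .
  have cring: "real (card (ring i)) \<le> K" for i
  proof -
    \<comment> \<open>The additive term \<open>R / 2\<close> takes at most half of the inner radius
      \<open>R * 2 ^ i\<close>; dividing what is left by \<alpha> gives this separation.\<close>
    define s where "s = R * 2 ^ i / (2 * \<alpha>)"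
    have R2: "R \<le> R * 2 ^ i" using R by simp
    have s0: "0 < s" unfolding s_def using R \<alpha>_gt_1 by simp
    have sr: "s \<le> R * 2 ^ Suc i"
    proof -
      have "s \<le> R * 2 ^ i / 1" unfolding s_def using R \<alpha>_gt_1 by (intro divide_left_mono) auto
      also have "\<dots> \<le> R * 2 ^ Suc i" using R by simp
      finally show ?thesis .
    qed
    have "s \<le> \<delta> u v" if "u \<in> ring i" "v \<in> ring i" "u \<noteq> v" for u v
    proof -
      have "\<delta> p u \<le> \<alpha> * \<delta> u v + R / 2" "R * 2 ^ i < \<delta> p u"
        using that sp unfolding ring_def spaced_def R_half by auto
      then have "R * 2 ^ i / 2 \<le> \<alpha> * \<delta> u v" using R2 by linarith
      then show ?thesis unfolding s_def using \<alpha>_gt_1 by (simp add: field_simps)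
    qed
    then have "real (card (ring i)) \<le> (4 * (R * 2 ^ Suc i) / s) powr dim"
      using A p s0 sr in_M unfolding ring_def by (intro card_packing_le_powr[OF p]) auto
    also have "4 * (R * 2 ^ Suc i) / s = 16 * \<alpha>"
      unfolding s_def using R \<alpha>_gt_1 by (simp add: field_simps)
    also have "(16 * \<alpha>) powr dim \<le> K" using \<alpha>\<tau> \<alpha>_gt_1 by (intro K) auto
    finally show ?thesis .
  qed
  have cover: "A \<subseteq> A0 \<union> (\<Union>i<m. ring i)"
  proof
    fix u assume u: "u \<in> A"
    have "log 2 \<Delta> \<le> real m" unfolding m_def by linarith
    then have "\<Delta> \<le> 2 ^ m" using \<Delta>1 by (simp add: log_le_iff powr_realpow)
    also have "\<dots> \<le> R * 2 ^ m" using R by simp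
    finally have top: "\<delta> p u \<le> R * 2 ^ m" using diam[OF p] A u by (meson order_trans subsetD)
    show "u \<in> A0 \<union> (\<Union>i<m. ring i)"
    proof (cases "\<delta> p u \<le> R")
      case True
      then show ?thesis using u unfolding A0_def by simp
    next
      case False
      \<comment> \<open>The first dyadic radius that reaches \<open>u\<close>. It is not the zeroth
        one because \<open>u\<close> lies outside the inner ball, and its predecessor is the index
        of the ring.\<close>
      define j where "j = (LEAST j. \<delta> p u \<le> R * 2 ^ j)"
      have j: "\<delta> p u \<le> R * 2 ^ j" "j \<le> m"
        unfolding j_def using top by (rule LeastI, rule Least_le)
      with False obtain i where i: "j = Suc i" by (cases j) auto
      have "\<not> \<delta> p u \<le> R * 2 ^ i"
        using not_less_Least[of i "\<lambda>j. \<delta> p u \<le> R * 2 ^ j"] i unfolding j_def by simp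
      then have "u \<in> ring i" using u j i unfolding ring_def by simp
      then show ?thesis using j i by auto
    qed
  qed
  have fin: "finite A0" "finite (ring i)" for i using finA unfolding A0_def ring_def by auto
  have "card A \<le> card A0 + card (\<Union>i<m. ring i)"
    using card_mono[OF _ cover] card_Un_le[of A0] fin by (meson finite_UN finite_UnI finite_lessThan order_trans)
  also have "card (\<Union>i<m. ring i) \<le> (\<Sum>i<m. card (ring i))" by (rule card_UN_le) simp
  finally have "card A \<le> card A0 + (\<Sum>i<m. card (ring i))" by simp
  then have "real (card A) \<le> real (card A0 + (\<Sum>i<m. card (ring i)))" by (rule of_nat_mono)
  also have "\<dots> = real (card A0) + (\<Sum>i<m. real (card (ring i)))" by simp
  also have "\<dots> \<le> K + (\<Sum>i<m. K)" using cA0 cring by (intro add_mono sum_mono) auto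
  also have "\<dots> = K * (real m + 1)" by (simp add: algebra_simps)
  \<comment> \<open>One unit for rounding \<open>m\<close> up and one for the inner ball; both are
    absorbed because \<open>log 2 (max 2 \<Delta>)\<close> is at least 1.\<close>
  also have "\<dots> \<le> K * (3 * log 2 (max 2 \<Delta>))"
  proof (rule mult_left_mono)
    have "0 \<le> log 2 \<Delta>" using \<Delta>1 by simp
    then have "real m \<le> log 2 \<Delta> + 1" unfolding m_def by linarith
    moreover have "log 2 \<Delta> \<le> log 2 (max 2 \<Delta>)" "1 \<le> log 2 (max 2 \<Delta>)" using \<Delta>1 by auto
    ultimately show "real m + 1 \<le> 3 * log 2 (max 2 \<Delta>)" by linarith
  qed (simp add: K_def)
  also have "\<dots> = 3 * 16 powr dim * degree_bound dim \<alpha> \<tau> \<Delta>"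
    unfolding K_def degree_bound_def by simp
  finally show ?thesis .
qed

end

locale convergent = convergent_params +
  fixes E
  assumes graph: "convergent_graph \<delta> \<alpha> \<tau> P E"
begin

lemma out_subset: "E `` {p} \<subseteq> P"
  using graph unfolding convergent_graph_def by auto

lemma finite_out [simp]: "finite (E `` {p})"
  using out_subset finite_P by (rule finite_subset)

lemma out_degree_le:
  assumes "p \<in> P"
  shows "real (card (E `` {p})) \<le> 3 * 16 powr dim * degree_bound dim \<alpha> \<tau> \<Delta>"
proof -
  obtain us where us: "sorted_wrt (\<lambda>u v. \<delta> p u \<le> \<delta> p v) us" "E `` {p} = select \<delta> \<alpha> \<tau> p {} us"
    using graph assms unfolding convergent_graph_def by blast
  have "spaced \<delta> \<alpha> \<tau> p (E `` {p})"
    unfolding us(2) using us(1) by (intro spaced_select) (auto simp: spaced_def commute)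
  then show ?thesis using assms out_subset by (intro card_spaced_le)
qed

lemma skipped:
  assumes "p \<in> P" "v \<in> P" "v \<noteq> p" "(p, v) \<notin> E"
  shows "\<exists>w \<in> E `` {p}. \<delta> p v > \<alpha> * \<delta> v w + (\<alpha> + 1) * \<tau>"
proof -
  obtain us where us: "set us = P - {p}" "E `` {p} = select \<delta> \<alpha> \<tau> p {} us"
    using graph assms unfolding convergent_graph_def by blast
  show ?thesis unfolding us(2) using assms us by (intro select_skipped) auto
qed

text \<open>Summing out-degrees gives the factor 3. The vertices add 1 per point, absorbed into a
  fourth unit since \<open>16 powr dim\<close> and the degree bound are both at least 1.\<close>

lemma graph_space_le:
  "real (graph_space P E) \<le> 4 * 16 powr dim * (real (card P) * degree_bound dim \<alpha> \<tau> \<Delta>)"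
proof -
  let ?B = "degree_bound dim \<alpha> \<tau> \<Delta>"
  have "E = Sigma P (\<lambda>p. E `` {p})" using graph unfolding convergent_graph_def by auto
  then have "card E = (\<Sum>p\<in>P. card (E `` {p}))"
    using card_SigmaI[OF finite_P, of "\<lambda>p. E `` {p}"] by simp
  then have "real (card E) \<le> (\<Sum>p\<in>P. 3 * 16 powr dim * ?B)"
    using out_degree_le by (simp only: of_nat_sum sum_mono)
  moreover have "1 * 1 \<le> 16 powr dim * ?B"
    using dim_ge_1 degree_bound_ge_1[of \<alpha> \<tau> dim] \<alpha>_gt_1 \<tau>_ge_1
    by (intro mult_mono) (auto simp: ge_one_powr_ge_zero)
  then have "real (card P) * 1 \<le> real (card P) * (16 powr dim * ?B)"
    by (intro mult_left_mono) auto
  ultimately show ?thesis unfolding graph_space_def by (simp add: algebra_simps)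
qed

end

section \<open>Greedy routing\<close>

lemma greedy_run_nth_step:
  assumes "greedy_run \<delta> E q s hs" "Suc i < length hs"
  shows "greedy_step \<delta> E q (hs ! i) (hs ! Suc i)"
  using assms unfolding greedy_run_def successively_conv_nth by blast

lemma greedy_run_nth_0: "greedy_run \<delta> E q s hs \<Longrightarrow> hs ! 0 = s"
  unfolding greedy_run_def by (cases hs) auto

lemma greedy_run_antimono:
  assumes "greedy_run \<delta> E q s hs" "i \<le> j" "j < length hs"
  shows "\<delta> (hs ! j) q \<le> \<delta> (hs ! i) q"
  using assms(2,3)
proof (induction rule: dec_induct)
  case (step j)
  then show ?case using greedy_run_nth_step[OF assms(1), of j] unfolding greedy_step_def by auto
qed simp

text \<open>Induction on the number of points strictly closer to \<open>q\<close> than the current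
  vertex. A hop decreases it, since its target is counted before the hop but not after.\<close>

lemma greedy_run_exists:
  assumes "finite P" "E \<subseteq> P \<times> P" "s \<in> P"
  shows "\<exists>hs. greedy_run \<delta> E q s hs"
  using assms(3)
proof (induction "card {x \<in> P. \<delta> x q < \<delta> s q}" arbitrary: s rule: less_induct)
  case less
  show ?case
  proof (cases "\<exists>u \<in> E `` {s}. \<delta> u q < \<delta> s q")
    case False
    then have "greedy_run \<delta> E q s [s]" unfolding greedy_run_def by simp
    then show ?thesis ..
  next
    case True
    have "E `` {s} \<subseteq> P" using assms(2) by blast
    then have "finite (E `` {s})" using assms(1) by (rule finite_subset)
    then obtain t where t: "is_arg_min (\<lambda>u. \<delta> u q) (\<lambda>u. u \<in> E `` {s}) t"
      using ex_is_arg_min_if_finite[of "E `` {s}" "\<lambda>u. \<delta> u q"] True by blast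
    then have closer: "\<delta> t q < \<delta> s q" using True unfolding is_arg_min_linorder by force
    with t have step: "greedy_step \<delta> E q s t" unfolding greedy_step_def by simp
    have tP: "t \<in> P" using t assms(2) unfolding is_arg_min_def by blast
    have "{x \<in> P. \<delta> x q < \<delta> t q} \<subset> {x \<in> P. \<delta> x q < \<delta> s q}"
      using closer tP by auto
    then have "card {x \<in> P. \<delta> x q < \<delta> t q} < card {x \<in> P. \<delta> x q < \<delta> s q}"
      using assms(1) by (intro psubset_card_mono) auto
    from less.hyps[OF this tP] obtain hs where "greedy_run \<delta> E q t hs" by blast
    then have "greedy_run \<delta> E q s (s # hs)"
      using step unfolding greedy_run_def by (cases hs) auto
    then show ?thesis ..
  qed
qed

lemma query_time_le:
  assumes "\<And>p. p \<in> set hs \<Longrightarrow> real (card (E `` {p})) \<le> b"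
  shows "real (query_time E hs) \<le> real (length hs) * b"
  using assms unfolding query_time_def by (induction hs) (fastforce simp: algebra_simps)+

section \<open>Contraction of the distance to the query\<close>

locale greedy_query = convergent +
  fixes q v s hs
  assumes q: "q \<in> M" and v: "nearest_neighbor \<delta> P q v" and s: "s \<in> P"
    and run: "greedy_run \<delta> E q s hs"
begin

text \<open>The fixed point of \<open>x \<mapsto> x / \<alpha> + (\<alpha> + 1) / \<alpha> * (\<delta> v q - \<tau>)\<close>, which bounds the distance
  to \<open>q\<close> after one hop.\<close>

definition fixpt :: real where
  "fixpt = (\<alpha> + 1) / (\<alpha> - 1) * (\<delta> v q - \<tau>)"

lemma v_in_P: "v \<in> P" and v_le: "p \<in> P \<Longrightarrow> \<delta> v q \<le> \<delta> p q"
  using v unfolding nearest_neighbor_def by auto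

lemma in_M: "p \<in> P \<Longrightarrow> p \<in> M"
  using P_sub by auto

lemma run_in_P: "i < length hs \<Longrightarrow> hs ! i \<in> P"
proof (induction i)
  case 0
  then show ?case using greedy_run_nth_0[OF run] s by simp
next
  case (Suc i)
  then show ?case
    using greedy_run_nth_step[OF run, of i] out_subset unfolding greedy_step_def is_arg_min_def by blast
qed

text \<open>The witness is the out-neighbour that blocked \<open>v\<close>. Two triangle
  inequalities, for \<open>p\<close> to \<open>v\<close> through \<open>q\<close> and for
  \<open>w\<close> to \<open>q\<close> through \<open>v\<close>, turn the blocking inequality into a
  contraction about \<open>fixpt\<close>. Discarding the nonnegative term
  \<open>\<alpha> * \<delta> v w\<close> instead shows that such a \<open>p\<close> is far from
  \<open>q\<close>.\<close>

lemma closer_out_neighbor: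
  assumes p: "p \<in> P" "p \<noteq> v" "(p, v) \<notin> E"
  shows "\<exists>w \<in> E `` {p}. \<alpha> * (\<delta> w q - fixpt) < \<delta> p q - fixpt"
    and "(\<alpha> + 1) * \<tau> < \<delta> p q + \<delta> v q"
proof -
  obtain w where w: "w \<in> E `` {p}" "\<delta> p v > \<alpha> * \<delta> v w + (\<alpha> + 1) * \<tau>"
    using skipped[OF p(1) v_in_P] p by blast
  have wP: "w \<in> P" using w(1) out_subset by blast
  have pv: "\<delta> p v \<le> \<delta> p q + \<delta> v q"
    using triangle[of p q v] p(1) q v_in_P in_M commute[of v q] by simp
  have "\<delta> w q \<le> \<delta> v w + \<delta> v q"
    using triangle[of w v q] wP q v_in_P in_M commute[of v w] by simp
  then have "\<alpha> * \<delta> w q \<le> \<alpha> * (\<delta> v w + \<delta> v q)" using \<alpha>_gt_1 by simp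
  then have "\<alpha> * \<delta> w q < \<delta> p q + (\<alpha> + 1) * (\<delta> v q - \<tau>)"
    using w(2) pv by (simp add: algebra_simps)
  moreover have "(\<alpha> - 1) * fixpt = (\<alpha> + 1) * (\<delta> v q - \<tau>)"
    unfolding fixpt_def using \<alpha>_gt_1 by simp
  ultimately have "\<alpha> * (\<delta> w q - fixpt) < \<delta> p q - fixpt" by (simp add: algebra_simps)
  with w(1) show "\<exists>w \<in> E `` {p}. \<alpha> * (\<delta> w q - fixpt) < \<delta> p q - fixpt" by blast
  have "0 \<le> \<alpha> * \<delta> v w" using \<alpha>_gt_1 by simp
  with w(2) pv show "(\<alpha> + 1) * \<tau> < \<delta> p q + \<delta> v q" by linarith
qed

lemma hop_progress:
  assumes i: "Suc i < length hs" and inexact: "\<delta> v q < \<delta> (hs ! Suc i) q"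
  shows "\<alpha> * (\<delta> (hs ! Suc i) q - fixpt) \<le> \<delta> (hs ! i) q - fixpt"
    and "(\<alpha> + 1) * \<tau> < \<delta> (hs ! i) q + \<delta> v q"
proof -
  have step: "\<And>u. u \<in> E `` {hs ! i} \<Longrightarrow> \<delta> (hs ! Suc i) q \<le> \<delta> u q"
    "\<delta> (hs ! Suc i) q < \<delta> (hs ! i) q"
    using greedy_run_nth_step[OF run i] unfolding greedy_step_def is_arg_min_def
    by (auto simp: not_less)
  \<comment> \<open>From \<open>v\<close> itself the strict decrease would go below
    \<open>\<delta> v q\<close>, and with an edge to \<open>v\<close> the greedy choice would be at
    least as close as \<open>v\<close>. Both contradict \<open>inexact\<close>.\<close>
  have p: "hs ! i \<in> P" "hs ! i \<noteq> v" "(hs ! i, v) \<notin> E"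
    using run_in_P[of i] i step inexact by force+
  show "(\<alpha> + 1) * \<tau> < \<delta> (hs ! i) q + \<delta> v q" using closer_out_neighbor(2)[OF p] .
  obtain w where w: "w \<in> E `` {hs ! i}" "\<alpha> * (\<delta> w q - fixpt) < \<delta> (hs ! i) q - fixpt"
    using closer_out_neighbor(1)[OF p] by blast
  have "\<alpha> * (\<delta> (hs ! Suc i) q - fixpt) \<le> \<alpha> * (\<delta> w q - fixpt)"
    using step(1)[OF w(1)] \<alpha>_gt_1 by simp
  with w(2) show "\<alpha> * (\<delta> (hs ! Suc i) q - fixpt) \<le> \<delta> (hs ! i) q - fixpt" by simp
qed

lemma geometric_progress:
  assumes "i < length hs" "\<And>j. 0 < j \<Longrightarrow> j \<le> i \<Longrightarrow> \<delta> v q < \<delta> (hs ! j) q"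
  shows "\<alpha> ^ i * (\<delta> (hs ! i) q - fixpt) \<le> \<delta> s q - fixpt"
  using assms
proof (induction i)
  case 0
  then show ?case using greedy_run_nth_0[OF run] by simp
next
  case (Suc i)
  have "\<alpha> ^ Suc i * (\<delta> (hs ! Suc i) q - fixpt) = \<alpha> ^ i * (\<alpha> * (\<delta> (hs ! Suc i) q - fixpt))"
    by simp
  also have "\<dots> \<le> \<alpha> ^ i * (\<delta> (hs ! i) q - fixpt)"
    using hop_progress(1) Suc.prems \<alpha>_gt_1 by (intro mult_left_mono) auto
  also have "\<dots> \<le> \<delta> s q - fixpt" using Suc by auto
  finally show ?case .
qed

lemma hs_nonempty: "hs \<noteq> []"
  using run unfolding greedy_run_def by simp

lemma last_in_P: "last hs \<in> P"
  using run_in_P[of "length hs - 1"] hs_nonempty by (simp add: last_conv_nth)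

text \<open>If neither \<open>v\<close> nor an edge to it is available at the end, the contracting
  out-neighbour \<open>w\<close> is no closer than the last vertex. Its inequality then holds with
  the last vertex on both sides, which forces the distance below \<open>fixpt\<close>.\<close>

lemma last_exact_or_less_fixpt:
  "\<delta> (last hs) q \<le> \<delta> v q \<or> \<delta> (last hs) q < fixpt"
proof (cases "last hs = v \<or> (last hs, v) \<in> E")
  case True
  then show ?thesis using run unfolding greedy_run_def by force
next
  case False
  then obtain w where w: "w \<in> E `` {last hs}" "\<alpha> * (\<delta> w q - fixpt) < \<delta> (last hs) q - fixpt"
    using closer_out_neighbor(1)[OF last_in_P] by blast
  have "\<delta> (last hs) q \<le> \<delta> w q" using run w(1) unfolding greedy_run_def by force
  then have "\<alpha> * (\<delta> (last hs) q - fixpt) \<le> \<alpha> * (\<delta> w q - fixpt)" using \<alpha>_gt_1 by simp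
  with w(2) have "(\<alpha> - 1) * (\<delta> (last hs) q - fixpt) < 0" by (simp add: algebra_simps)
  then show ?thesis using \<alpha>_gt_1 by (simp add: mult_less_0_iff)
qed

lemma start_dist_le: "\<delta> s q \<le> \<Delta> + \<delta> v q"
  using triangle[of s v q] s q v_in_P in_M diam[of s v] by simp

lemma degree_le: "p \<in> set hs \<Longrightarrow> real (card (E `` {p})) \<le> 3 * 16 powr dim * degree_bound dim \<alpha> \<tau> \<Delta>"
  using run_in_P by (auto simp: in_set_conv_nth intro!: out_degree_le)

text \<open>For a near query \<open>fixpt\<close> is not positive, so no distance lies below it and
  only the exact alternative survives.\<close>

lemma last_nearest:
  assumes near: "\<delta> q v \<le> \<tau>"
  shows "nearest_neighbor \<delta> P q (last hs)"
proof -
  have "fixpt \<le> 0" unfolding fixpt_def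
    using near \<alpha>_gt_1 commute[of q v] by (intro mult_nonneg_nonpos) auto
  moreover have "0 \<le> \<delta> (last hs) q" by simp
  ultimately have "\<delta> (last hs) q \<le> \<delta> v q" using last_exact_or_less_fixpt by linarith
  then show ?thesis using last_in_P v unfolding nearest_neighbor_def by force
qed

lemma power_length_less:
  assumes near: "\<delta> q v \<le> \<tau>" and L: "length hs \<ge> 3"
  shows "\<alpha> ^ (length hs - 2) < 2 * \<Delta>"
proof -
  \<comment> \<open>Vertex \<open>i\<close> is the third from the end. Its successor is still
    inexact, because one more strict decrease follows it; only the very last vertex may already be a
    nearest neighbour.\<close>
  define i where "i = length hs - 3"
  have i: "Suc (Suc i) < length hs" "length hs - 2 = Suc i" unfolding i_def using L by auto
  have inexact: "\<delta> v q < \<delta> (hs ! j) q" if "j \<le> Suc i" for j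
  proof -
    have "\<delta> v q \<le> \<delta> (hs ! Suc (Suc i)) q" using i by (intro v_le run_in_P)
    also have "\<dots> < \<delta> (hs ! Suc i) q"
      using greedy_run_nth_step[OF run i(1)] unfolding greedy_step_def by simp
    also have "\<dots> \<le> \<delta> (hs ! j) q" using that i by (intro greedy_run_antimono[OF run]) auto
    finally show ?thesis .
  qed
  have f: "fixpt \<le> 0" unfolding fixpt_def
    using near \<alpha>_gt_1 commute[of q v] by (intro mult_nonneg_nonpos) auto
  have pow: "1 \<le> \<alpha> ^ i" using \<alpha>_gt_1 by simp
  have "\<alpha> ^ i * (\<delta> (hs ! i) q - fixpt) \<le> \<delta> s q - fixpt"
    using i inexact by (intro geometric_progress) auto
  \<comment> \<open>Since \<open>fixpt\<close> is not positive, dropping it from both sides only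
    weakens the contraction.\<close>
  moreover have "\<alpha> ^ i * fixpt \<le> 1 * fixpt" using pow f by (intro mult_right_mono_neg) auto
  ultimately have decay: "\<alpha> ^ i * \<delta> (hs ! i) q \<le> \<delta> s q" by (simp add: algebra_simps)
  have "(\<alpha> + 1) * \<tau> < \<delta> (hs ! i) q + \<delta> v q" using i inexact by (intro hop_progress) auto
  then have "\<alpha> * \<tau> < \<delta> (hs ! i) q" using near commute[of q v] by (simp add: algebra_simps)
  \<comment> \<open>The lower bound \<alpha> on the distance at hop \<open>i\<close> supplies the
    additional factor that raises the exponent from \<open>i\<close> to
    \<open>Suc i\<close>.\<close>
  moreover have "\<alpha> \<le> \<alpha> * \<tau>" using \<alpha>_gt_1 \<tau>_ge_1 by simp
  ultimately have "\<alpha> < \<delta> (hs ! i) q" by simp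
  then have "\<alpha> ^ i * \<alpha> < \<alpha> ^ i * \<delta> (hs ! i) q" using \<alpha>_gt_1 by (intro mult_strict_left_mono) auto
  with decay have "\<alpha> ^ Suc i < \<delta> s q" by (simp add: mult.commute)
  also have "\<dots> \<le> 2 * \<Delta>" using start_dist_le near \<tau>_le commute[of q v] by simp
  finally show ?thesis using i by simp
qed

end

text \<open>With \<open>t = a / x\<close>, enlarging the base from \<open>x\<close> to
  \<open>a\<close> gains \<open>t powr D\<close>, at least \<open>t\<close>, while
  \<open>log a x\<close> loses a factor \<open>ln a / ln x\<close>. This loss is at most
  \<open>2 * t\<close>, because \<open>ln t \<le> t - 1\<close> and
  \<open>ln x \<ge> 1 / 2\<close>.\<close>

lemma powr_le_powr_mult_log:
  fixes x a D :: real
  assumes "2 \<le> x" "x \<le> a" "1 \<le> D"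
  shows "x powr D \<le> 2 * (a powr D * log a x)"
proof -
  define t where "t = a / x"
  have t: "1 \<le> t" "a = x * t" unfolding t_def using assms by (auto simp: field_simps)
  have "1 / 2 \<le> ln (2::real)" using ln_le_minus_one[of "1 / 2"] by (simp add: ln_div)
  also have "\<dots> \<le> ln x" using assms by simp
  finally have lnx: "1 / 2 \<le> ln x" .
  have "ln a = ln x + ln t" using t assms by (simp add: ln_mult)
  also have "\<dots> \<le> ln x + (t - 1)" using ln_le_minus_one[of t] t by simp
  also have "t - 1 \<le> 2 * ln x * (t - 1)" using lnx t mult_right_mono[of 1 "2 * ln x" "t - 1"] by simp
  also have "ln x + 2 * ln x * (t - 1) \<le> 2 * t * ln x" using lnx by (simp add: algebra_simps)
  also have "\<dots> \<le> 2 * t powr D * ln x"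
    using powr_mono[of 1 D t] t assms lnx by (intro mult_right_mono) auto
  finally have "ln a \<le> 2 * t powr D * ln x" by simp
  then have "1 \<le> 2 * t powr D * log a x" using assms unfolding log_def by (simp add: field_simps)
  then have "x powr D * 1 \<le> x powr D * (2 * t powr D * log a x)" by (intro mult_left_mono) auto
  also have "\<dots> = 2 * (a powr D * log a x)" using t assms by (simp add: powr_mult)
  finally show ?thesis by simp
qed

section \<open>Query time for near and far queries\<close>

context greedy_query
begin

text \<open>When \<open>\<alpha>\<close> exceeds \<open>max 2 \<Delta>\<close>, the factor \<open>log \<alpha> (max 2 \<Delta>)\<close> drops below 1 and no longer pays
  for even one hop at the cost of the degree bound.  There are at most three hop vertices then, and \<open>card P\<close>
  bounds the degrees well enough because \<open>dim \<ge> 1\<close>.\<close>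

lemma query_time_exact:
  assumes near: "\<delta> q v \<le> \<tau>"
  shows "real (query_time E hs) \<le> 24 * 16 powr dim * (degree_bound dim \<alpha> \<tau> \<Delta> * log \<alpha> (max 2 \<Delta>))"
proof -
  define B where "B = degree_bound dim \<alpha> \<tau> \<Delta>"
  define X where "X = max 2 \<Delta>"
  have B: "1 \<le> B" unfolding B_def using \<alpha>_gt_1 \<tau>_ge_1 dim_ge_1 by (intro degree_bound_ge_1) auto
  have X: "2 \<le> X" "\<Delta> \<le> X" "0 < \<Delta>" "1 \<le> \<Delta>" unfolding X_def using \<tau>_ge_1 \<tau>_le by auto
  \<comment> \<open>Replacing \<open>2 * \<Delta>\<close> by a square makes the hop bound a multiple
    of \<open>log \<alpha> X\<close> instead of leaving an additive
    \<open>log \<alpha> 2\<close>.\<close>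
  have "2 * \<Delta> \<le> X * X" using X by (intro mult_mono) auto
  then have dX: "2 * \<Delta> \<le> X ^ 2" by (simp add: power2_eq_square)
  show ?thesis
  proof (cases "\<alpha> \<le> X")
    case True
    have l1: "1 \<le> log \<alpha> X" using True \<alpha>_gt_1 X by (simp add: le_log_iff)
    have "real (length hs) \<le> 2 + 2 * log \<alpha> X"
    proof (cases "length hs \<ge> 3")
      case L: True
      have "\<alpha> ^ (length hs - 2) \<le> X ^ 2" using power_length_less[OF near L] dX by simp
      then have "log \<alpha> (\<alpha> ^ (length hs - 2)) \<le> log \<alpha> (X ^ 2)"
        using \<alpha>_gt_1 X by (subst log_le_cancel_iff) auto
      then have "real (length hs - 2) \<le> 2 * log \<alpha> X"
        using \<alpha>_gt_1 X by (simp add: log_nat_power)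
      then show ?thesis using L by linarith
    qed (use l1 in linarith)
    then have L: "real (length hs) \<le> 4 * log \<alpha> X" using l1 by linarith
    have "real (query_time E hs) \<le> real (length hs) * (3 * 16 powr dim * B)"
      unfolding B_def using degree_le by (rule query_time_le)
    also have "\<dots> \<le> (4 * log \<alpha> X) * (3 * 16 powr dim * B)" using L B by (intro mult_right_mono) auto
    also have "\<dots> = 12 * 16 powr dim * (B * log \<alpha> X)" by simp
    also have "\<dots> \<le> 24 * 16 powr dim * (B * log \<alpha> X)" using B l1 by (intro mult_right_mono) auto
    finally show ?thesis unfolding B_def X_def .
  next
    case False
    have "length hs \<le> 3"
    proof (rule ccontr)
      assume L: "\<not> length hs \<le> 3"
      then have "\<alpha> ^ (length hs - 2) < X ^ 2" using power_length_less[OF near] dX by simp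
      also have "\<dots> \<le> \<alpha> ^ 2" using False X by (intro power_mono) auto
      finally have "length hs - 2 < 2" using \<alpha>_gt_1 by simp
      with L show False by simp
    qed
    then have L: "real (length hs) \<le> 3" by simp
    have "real (query_time E hs) \<le> real (length hs) * real (card P)"
      using out_subset finite_P by (intro query_time_le) (simp add: card_mono)
    also have "\<dots> \<le> 3 * (4 * \<Delta>) powr dim"
      using L card_P_le[OF diam] X by (intro mult_mono) auto
    also have "\<dots> \<le> 3 * (4 * X) powr dim" using X dim_ge_1 by (intro mult_left_mono powr_mono2) auto
    also have "\<dots> = 3 * (4 powr dim * X powr dim)" using X by (simp add: powr_mult)
    \<comment> \<open>Here \<open>X\<close> is below \<alpha>, so the missing logarithmic factor is
      paid for by the larger power of \<alpha>.\<close>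
    also have "\<dots> \<le> 3 * (16 powr dim * (2 * (\<alpha> powr dim * log \<alpha> X)))"
      using powr_le_powr_mult_log[of X \<alpha> dim] False X dim_ge_1
      by (intro mult_left_mono mult_mono powr_mono2) auto
    also have "\<dots> = 6 * 16 powr dim * (\<alpha> powr dim * log \<alpha> X)" by simp
    also have "\<dots> \<le> 24 * 16 powr dim * (B * log \<alpha> X)"
    proof (intro mult_mono)
      have "\<alpha> powr dim * 1 \<le> (\<alpha> * \<tau>) powr dim * log 2 X"
        using \<alpha>_gt_1 \<tau>_ge_1 dim_ge_1 X by (intro mult_mono powr_mono2) (auto simp: le_log_iff)
      then show "\<alpha> powr dim \<le> B" unfolding B_def degree_bound_def X_def by simp
    qed (use \<alpha>_gt_1 X B in auto)
    finally show ?thesis unfolding B_def X_def .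
  qed
qed

lemma approx_of_dist_le:
  assumes "p \<in> P" "\<delta> p q \<le> c * \<delta> v q" "0 \<le> c"
  shows "approx_nearest_neighbor \<delta> P c q p"
  unfolding approx_nearest_neighbor_def
proof (intro conjI ballI)
  fix p' assume "p' \<in> P"
  then have "c * \<delta> v q \<le> c * \<delta> p' q" using v_le assms(3) by (intro mult_left_mono)
  with assms(2) show "\<delta> p q \<le> c * \<delta> p' q" by simp
qed (rule assms(1))

text \<open>Let \<open>k\<close> be the first hop within the desired ratio; distances only decrease
  afterwards, so every later hop qualifies too. Each earlier hop exceeds \<open>fixpt\<close> by at
  least \<open>\<epsilon> * \<delta> v q + \<rho> * \<tau>\<close>, and geometric decay bounds how
  many there can be.\<close>

lemma query_time_approx:
  assumes far: "\<not> \<delta> q v \<le> \<tau>" and \<epsilon>: "\<epsilon> > 0"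
  shows "\<exists>k<length hs.
    (\<forall>j. k \<le> j \<and> j < length hs \<longrightarrow>
      approx_nearest_neighbor \<delta> P ((\<alpha> + 1) / (\<alpha> - 1) + \<epsilon>) q (hs ! j)) \<and>
    real (query_time E (take (Suc k) hs))
      \<le> 24 * 16 powr dim * (degree_bound dim \<alpha> \<tau> \<Delta> * max 1 (log \<alpha> (\<Delta> / ((\<alpha> - 1) * \<epsilon>))))"
proof -
  define \<rho> where "\<rho> = (\<alpha> + 1) / (\<alpha> - 1)"
  define B where "B = degree_bound dim \<alpha> \<tau> \<Delta>"
  define l where "l = max 1 (log \<alpha> (\<Delta> / ((\<alpha> - 1) * \<epsilon>)))"
  define good where "good i \<longleftrightarrow> \<delta> (hs ! i) q \<le> (\<rho> + \<epsilon>) * \<delta> v q" for i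
  define k where "k = (LEAST i. good i)"
  have B: "1 \<le> B" unfolding B_def using \<alpha>_gt_1 \<tau>_ge_1 dim_ge_1 by (intro degree_bound_ge_1) auto
  have \<rho>: "1 \<le> \<rho>" unfolding \<rho>_def using \<alpha>_gt_1 by simp
  have D: "\<tau> < \<delta> v q" "1 < \<delta> v q" using far \<tau>_ge_1 commute[of q v] by auto
  have \<Delta>: "1 \<le> \<Delta>" using \<tau>_ge_1 \<tau>_le by simp
  have exact: "\<delta> v q \<le> (\<rho> + \<epsilon>) * \<delta> v q" using D \<rho> \<epsilon> by simp
  have fix_eq: "fixpt = \<rho> * \<delta> v q - \<rho> * \<tau>" unfolding fixpt_def \<rho>_def by (rule right_diff_distrib)
  have "0 \<le> \<rho> * \<tau>" "0 \<le> \<epsilon> * \<delta> v q" using \<rho> \<tau>_ge_1 \<epsilon> D by auto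
  then have "fixpt \<le> (\<rho> + \<epsilon>) * \<delta> v q" unfolding fix_eq by (simp add: algebra_simps)
  then have "\<delta> (last hs) q \<le> (\<rho> + \<epsilon>) * \<delta> v q"
    using last_exact_or_less_fixpt exact by linarith
  \<comment> \<open>The returned vertex qualifies, so the least good index exists and lies within
    the run.\<close>
  then have last: "good (length hs - 1)" unfolding good_def using hs_nonempty by (simp add: last_conv_nth)
  then have good_k: "good k" and "k \<le> length hs - 1" unfolding k_def by (rule LeastI, rule Least_le)
  then have k: "k < length hs" using hs_nonempty by (cases hs) auto
  have approx: "approx_nearest_neighbor \<delta> P (\<rho> + \<epsilon>) q (hs ! j)" if "k \<le> j" "j < length hs" for j
  proof (rule approx_of_dist_le)
    show "\<delta> (hs ! j) q \<le> (\<rho> + \<epsilon>) * \<delta> v q"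
      using greedy_run_antimono[OF run that] good_k unfolding good_def by linarith
  qed (use run_in_P that \<rho> \<epsilon> in auto)
  have bad: "(\<rho> + \<epsilon>) * \<delta> v q < \<delta> (hs ! j) q" if "j < k" for j
    using not_less_Least[of j good] that unfolding k_def good_def by simp
  have "real k + 1 \<le> 4 * l"
  proof (cases k)
    case 0
    then show ?thesis unfolding l_def by linarith
  next
    case (Suc i)
    have pow: "1 \<le> \<alpha> ^ i" using \<alpha>_gt_1 by simp
    have "\<alpha> ^ i * (\<epsilon> * \<delta> v q + \<rho> * \<tau>) \<le> \<alpha> ^ i * (\<delta> (hs ! i) q - fixpt)"
      using bad[of i] Suc pow by (intro mult_left_mono) (auto simp: fix_eq algebra_simps)
    also have "\<dots> \<le> \<delta> s q - fixpt"
      using Suc k bad exact by (intro geometric_progress) (auto intro: le_less_trans)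
    also have "\<dots> \<le> \<Delta> + \<rho> * \<tau>"
    proof -
      have "1 * \<delta> v q \<le> \<rho> * \<delta> v q" using \<rho> by (intro mult_right_mono) auto
      then show ?thesis using start_dist_le unfolding fix_eq by linarith
    qed
    finally have "\<alpha> ^ i * (\<epsilon> * \<delta> v q) + \<alpha> ^ i * (\<rho> * \<tau>) \<le> \<Delta> + \<rho> * \<tau>" by (simp add: algebra_simps)
    \<comment> \<open>The \<tau> part of the excess cancels the same term on the right. Together
      with \<open>\<delta> v q > 1\<close> this leaves an inequality in which only \<Delta> and
      \<epsilon> bound the power.\<close>
    moreover have "1 * (\<rho> * \<tau>) \<le> \<alpha> ^ i * (\<rho> * \<tau>)" using pow \<rho> \<tau>_ge_1 by (intro mult_right_mono) auto
    moreover have "\<alpha> ^ i * (\<epsilon> * 1) \<le> \<alpha> ^ i * (\<epsilon> * \<delta> v q)"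
      using pow \<epsilon> D by (intro mult_left_mono) auto
    ultimately have "\<alpha> ^ i * \<epsilon> \<le> \<Delta>" by simp
    then have "\<alpha> ^ i \<le> \<Delta> / \<epsilon>" using \<epsilon> by (simp add: field_simps)
    also have "\<dots> = \<Delta> / ((\<alpha> - 1) * \<epsilon>) * (\<alpha> - 1)" using \<alpha>_gt_1 by simp
    \<comment> \<open>Trading \<open>\<alpha> - 1\<close> for \<alpha> produces the argument of the
      stated logarithm at the price of a single extra hop.\<close>
    also have "\<dots> \<le> \<Delta> / ((\<alpha> - 1) * \<epsilon>) * \<alpha>"
      using \<epsilon> \<alpha>_gt_1 \<Delta> by (intro mult_left_mono) auto
    finally have "log \<alpha> (\<alpha> ^ i) \<le> log \<alpha> (\<Delta> / ((\<alpha> - 1) * \<epsilon>) * \<alpha>)"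
      using \<alpha>_gt_1 \<epsilon> \<Delta> by (subst log_le_cancel_iff) auto
    also have "\<dots> = log \<alpha> (\<Delta> / ((\<alpha> - 1) * \<epsilon>)) + log \<alpha> \<alpha>"
      using \<alpha>_gt_1 \<epsilon> \<Delta> by (intro log_mult_pos) auto
    finally have "real i \<le> log \<alpha> (\<Delta> / ((\<alpha> - 1) * \<epsilon>)) + 1"
      using \<alpha>_gt_1 by (simp add: log_nat_power)
    then show ?thesis using Suc unfolding l_def by linarith
  qed
  have "real (query_time E (take (Suc k) hs)) \<le> real (length (take (Suc k) hs)) * (3 * 16 powr dim * B)"
    unfolding B_def by (intro query_time_le degree_le) (meson in_set_takeD)
  also have "\<dots> \<le> (4 * l) * (3 * 16 powr dim * B)"
    using B k \<open>real k + 1 \<le> 4 * l\<close> by (intro mult_right_mono) auto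
  also have "\<dots> = 12 * 16 powr dim * (B * l)" by simp
  also have "\<dots> \<le> 24 * 16 powr dim * (B * l)"
    using B unfolding l_def by (intro mult_right_mono) auto
  finally show ?thesis using k approx unfolding \<rho>_def B_def l_def by blast
qed

end

section \<open>Construction\<close>

lemma with_distances_val:
  "val (with_distances \<delta> p us) = map (\<lambda>u. (\<delta> p u, u)) (filter (\<lambda>u. u \<noteq> p) us)"
  by (induction us) auto

lemma with_distances_steps: "steps (with_distances \<delta> p us) = length us + 1"
  by (induction us) auto

section \<open>Correctness and cost of merge sort\<close>

lemma halve_mset: "mset (fst (val (halve zs))) + mset (snd (val (halve zs))) = mset zs"
  by (induction zs rule: halve.induct) (auto split: prod.splits)

lemma halve_lengths:
  "length (fst (val (halve zs))) = (length zs + 1) div 2"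
  "length (snd (val (halve zs))) = length zs div 2"
  by (induction zs rule: halve.induct) (auto split: prod.splits)

lemma halve_steps: "steps (halve zs) = length zs div 2 + 1"
  by (induction zs rule: halve.induct) (auto split: prod.splits)

lemma merge_mset: "mset (val (merge xs ys)) = mset xs + mset ys"
  by (induction xs ys rule: merge.induct) auto

lemma merge_sorted:
  assumes "sorted (map fst xs)" "sorted (map fst ys)"
  shows "sorted (map fst (val (merge xs ys)))"
  using assms
proof (induction xs ys rule: merge.induct)
  case (3 x xs y ys)
  have set: "set (val (merge us vs)) = set us \<union> set vs" for us vs :: "(real \<times> 'a) list"
    using merge_mset[of us vs] by (metis set_mset_mset set_mset_union)
  show ?case using 3 by (auto simp: set)
qed auto

lemma merge_steps: "steps (merge xs ys) \<le> length xs + length ys + 1"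
  by (induction xs ys rule: merge.induct) auto

lemma msort_mset: "mset (val (msort zs)) = mset zs"
proof (induction zs rule: msort.induct)
  case (3 x y zs)
  obtain us vs where uv: "val (halve (x # y # zs)) = (us, vs)" by fastforce
  then show ?case
    using 3 halve_mset[of "x # y # zs"] by (simp add: merge_mset del: halve.simps)
qed auto

lemma msort_sorted: "sorted (map fst (val (msort zs)))"
proof (induction zs rule: msort.induct)
  case (3 x y zs)
  obtain us vs where uv: "val (halve (x # y # zs)) = (us, vs)" by fastforce
  then show ?case using 3 by (simp add: merge_sorted del: halve.simps)
qed auto

text \<open>\<open>h\<close> bounds the recursion depth: if the list fits into \<open>2 ^ h\<close>,
  both halves fit into half of that. One level costs at most \<open>5 + n div 2 + n\<close> steps,
  below \<open>6 * n\<close> once the length \<open>n\<close> is at least 2.\<close>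

lemma msort_steps:
  assumes "length zs \<le> 2 ^ h"
  shows "steps (msort zs) \<le> 6 * length zs * h + 1"
  using assms
proof (induction zs arbitrary: h rule: msort.induct)
  case (3 x y zs)
  let ?n = "length (x # y # zs)"
  obtain us vs where uv: "val (halve (x # y # zs)) = (us, vs)" by fastforce
  obtain h' where h: "h = Suc h'" using "3.prems" by (cases h) auto
  have len: "length us = (?n + 1) div 2" "length vs = ?n div 2"
    using halve_lengths[of "x # y # zs"] uv by (simp_all del: halve.simps)
  then have sum: "length us + length vs = ?n" by simp
  have lens: "length us \<le> 2 ^ h'" "length vs \<le> 2 ^ h'" using len "3.prems" h by auto
  have lmerge: "length (val (msort us)) = length us" for us :: "(real \<times> 'a) list"
    by (metis msort_mset size_mset)
  have "steps (msort (x # y # zs)) = 1 + steps (halve (x # y # zs)) + steps (msort us)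
      + steps (msort vs) + steps (merge (val (msort us)) (val (msort vs)))"
    using uv by (simp del: halve.simps)
  also have "\<dots> \<le> 1 + (?n div 2 + 1) + (6 * length us * h' + 1) + (6 * length vs * h' + 1) + (?n + 1)"
    using "3.IH"(1)[OF refl refl uv[symmetric] lens(1)]
      "3.IH"(2)[OF refl refl uv[symmetric] refl lens(2)]
      merge_steps[of "val (msort us)" "val (msort vs)"] halve_steps[of "x # y # zs"] sum
    by (simp add: lmerge del: halve.simps)
  also have "\<dots> = 5 + ?n div 2 + ?n + 6 * (length us + length vs) * h'"
    by (simp add: algebra_simps)
  also have "\<dots> \<le> 6 * ?n * h + 1"
    unfolding sum h by (simp add: algebra_simps)
  finally show ?case .
qed auto

section \<open>Pruning and the adjacency lists\<close>

lemma blocked_val: "val (blocked \<delta> \<alpha> \<tau> r u vs) \<longleftrightarrow> (\<exists>v\<in>set vs. r > \<alpha> * \<delta> u v + (\<alpha> + 1) * \<tau>)"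
  by (induction vs) auto

lemma blocked_steps: "steps (blocked \<delta> \<alpha> \<tau> r u vs) \<le> length vs + 1"
  by (induction vs) auto

text \<open>The assumption says that the stored keys are the distances from \<open>p\<close>. The
  list accumulates points in reverse, so agreement is claimed for its set only.\<close>

lemma prune_val:
  assumes "\<And>r u. (r, u) \<in> set rs \<Longrightarrow> r = \<delta> p u"
  shows "set (val (prune \<delta> \<alpha> \<tau> vs rs)) = select \<delta> \<alpha> \<tau> p (set vs) (map snd rs)"
  using assms
proof (induction rs arbitrary: vs)
  case (Cons ru rs)
  obtain u where ru: "ru = (\<delta> p u, u)" using Cons.prems by (cases ru) auto
  have "set (val (prune \<delta> \<alpha> \<tau> ws rs)) = select \<delta> \<alpha> \<tau> p (set ws) (map snd rs)" for ws
    using Cons.prems by (intro Cons.IH) auto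
  then show ?case by (simp add: ru blocked_val)
qed simp

lemma prune_distinct:
  "distinct (vs @ map snd rs) \<Longrightarrow> distinct (val (prune \<delta> \<alpha> \<tau> vs rs))"
  by (induction \<delta> \<alpha> \<tau> vs rs rule: prune.induct) auto

lemma prune_length: "length vs \<le> length (val (prune \<delta> \<alpha> \<tau> vs rs))"
proof (induction rs arbitrary: vs)
  case (Cons ru rs)
  show ?case using Cons[of vs] Cons[of "snd ru # vs"] by (cases ru) auto
qed simp

text \<open>An output-sensitive bound: the accumulator never shrinks, so each scan by
  \<open>blocked\<close> is no longer than the final list plus one. This lets the out-degree bound
  control the running time.\<close>

lemma prune_steps:
  "steps (prune \<delta> \<alpha> \<tau> vs rs) \<le> length rs * (length (val (prune \<delta> \<alpha> \<tau> vs rs)) + 2) + 1"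
proof (induction rs arbitrary: vs)
  case (Cons ru rs)
  obtain r u where ru: "ru = (r, u)" by fastforce
  define ws where "ws = (if val (blocked \<delta> \<alpha> \<tau> r u vs) then vs else u # vs)"
  have "length vs \<le> length (val (prune \<delta> \<alpha> \<tau> ws rs))"
    using prune_length[of ws \<delta> \<alpha> \<tau> rs] unfolding ws_def by (auto split: if_splits)
  then have "steps (blocked \<delta> \<alpha> \<tau> r u vs) \<le> length (val (prune \<delta> \<alpha> \<tau> ws rs)) + 1"
    using blocked_steps[of \<delta> \<alpha> \<tau> r u vs] by linarith
  then show ?case using Cons[of ws] by (simp add: ru flip: ws_def)
qed simp

lemma build_from_val:
  "val (build_from \<delta> \<alpha> \<tau> ps rest) = map (\<lambda>p. (p, val (out_list \<delta> \<alpha> \<tau> ps p))) rest"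
  by (induction rest) auto

lemma build_from_steps:
  "steps (build_from \<delta> \<alpha> \<tau> ps rest) = (\<Sum>p\<leftarrow>rest. steps (out_list \<delta> \<alpha> \<tau> ps p) + 1) + 1"
  by (induction rest) auto

lemma edges_of_build_graph:
  "edges_of (val (build_graph \<delta> \<alpha> \<tau> ps)) `` {p} =
     (if p \<in> set ps then set (val (out_list \<delta> \<alpha> \<tau> ps p)) else {})"
  unfolding edges_of_def build_graph_def build_from_val by auto

text \<open>The order \<open>us\<close> is whatever order the sort produces, ties included.
  Comparing multisets rather than sets also carries over distinctness, so the length of the output
  is an out-degree.\<close>

lemma out_list_props:
  assumes "distinct ps"
  shows "\<exists>us. distinct us \<and> set us = set ps - {p} \<and> sorted_wrt (\<lambda>u v. \<delta> p u \<le> \<delta> p v) us \<and>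
           set (val (out_list \<delta> \<alpha> \<tau> ps p)) = select \<delta> \<alpha> \<tau> p {} us"
    and "distinct (val (out_list \<delta> \<alpha> \<tau> ps p))"
proof -
  define rs where "rs = val (msort (val (with_distances \<delta> p ps)))"
  define us where "us = map snd rs"
  have m: "mset rs = mset (map (\<lambda>u. (\<delta> p u, u)) (filter (\<lambda>u. u \<noteq> p) ps))"
    unfolding rs_def by (simp add: msort_mset with_distances_val)
  then have set_rs: "set rs = (\<lambda>u. (\<delta> p u, u)) ` (set ps - {p})"
    using mset_eq_setD by fastforce
  have mset_us: "mset us = mset (filter (\<lambda>u. u \<noteq> p) ps)"
    unfolding us_def mset_map m by (simp add: multiset.map_comp comp_def)
  have us: "distinct us" "set us = set ps - {p}"
    using mset_eq_imp_distinct_iff[OF mset_us] mset_eq_setD[OF mset_us] assms by auto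
  have out: "val (out_list \<delta> \<alpha> \<tau> ps p) = val (prune \<delta> \<alpha> \<tau> [] rs)"
    unfolding out_list_def rs_def by simp
  have "map fst rs = map (\<delta> p) us"
    unfolding us_def using set_rs by auto
  then have "sorted (map (\<delta> p) us)" using msort_sorted unfolding rs_def by metis
  then have "sorted_wrt (\<lambda>u v. \<delta> p u \<le> \<delta> p v) us" by (simp add: sorted_wrt_map)
  moreover have "set (val (out_list \<delta> \<alpha> \<tau> ps p)) = select \<delta> \<alpha> \<tau> p {} us"
    unfolding out us_def using set_rs by (subst prune_val[where p = p]) auto
  ultimately show "\<exists>us. distinct us \<and> set us = set ps - {p} \<and>
      sorted_wrt (\<lambda>u v. \<delta> p u \<le> \<delta> p v) us \<and>
      set (val (out_list \<delta> \<alpha> \<tau> ps p)) = select \<delta> \<alpha> \<tau> p {} us"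
    using us by blast
  show "distinct (val (out_list \<delta> \<alpha> \<tau> ps p))"
    unfolding out using us(1) by (intro prune_distinct) (simp add: us_def)
qed

lemma convergent_graph_build_graph:
  assumes "distinct ps"
  shows "convergent_graph \<delta> \<alpha> \<tau> (set ps) (edges_of (val (build_graph \<delta> \<alpha> \<tau> ps)))"
  unfolding convergent_graph_def
proof (intro conjI ballI)
  have "set (val (out_list \<delta> \<alpha> \<tau> ps p)) \<subseteq> set ps" for p
    using out_list_props(1)[OF assms, of p \<delta> \<alpha> \<tau>] select_subset[of \<delta> \<alpha> \<tau> p "{}"] by fastforce
  then show "edges_of (val (build_graph \<delta> \<alpha> \<tau> ps)) \<subseteq> set ps \<times> set ps"
    unfolding edges_of_def build_graph_def build_from_val by auto
next
  fix p assume "p \<in> set ps"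
  then show "\<exists>us. distinct us \<and> set us = set ps - {p} \<and> sorted_wrt (\<lambda>u v. \<delta> p u \<le> \<delta> p v) us \<and>
      edges_of (val (build_graph \<delta> \<alpha> \<tau> ps)) `` {p} = select \<delta> \<alpha> \<tau> p {} us"
    unfolding edges_of_build_graph using out_list_props(1)[OF assms, of p \<delta> \<alpha> \<tau>] by simp
qed

lemma out_list_steps:
  assumes "length ps \<le> 2 ^ h"
  shows "steps (out_list \<delta> \<alpha> \<tau> ps p)
    \<le> length ps * (length (val (out_list \<delta> \<alpha> \<tau> ps p)) + 6 * h + 3) + 4"
proof -
  define ds where "ds = val (with_distances \<delta> p ps)"
  define rs where "rs = val (msort ds)"
  have ds: "length ds \<le> length ps" unfolding ds_def with_distances_val by simp
  have rs: "length rs = length ds" unfolding rs_def by (metis msort_mset size_mset)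
  define m where "m = length (val (prune \<delta> \<alpha> \<tau> [] rs))"
  have "steps (out_list \<delta> \<alpha> \<tau> ps p) =
      1 + (length ps + 1) + steps (msort ds) + steps (prune \<delta> \<alpha> \<tau> [] rs)"
    unfolding out_list_def rs_def ds_def by (simp add: with_distances_steps)
  also have "\<dots> \<le> 1 + (length ps + 1) + (6 * length ds * h + 1) + (length rs * (m + 2) + 1)"
    unfolding m_def using msort_steps[of ds h] ds assms prune_steps[of \<delta> \<alpha> \<tau> "[]" rs]
    by (intro add_mono) auto
  also have "\<dots> \<le> 1 + (length ps + 1) + (6 * length ps * h + 1) + (length ps * (m + 2) + 1)"
    using ds rs by (intro add_mono mult_mono) auto
  also have "\<dots> = length ps * (m + 6 * h + 3) + 4" by (simp add: algebra_simps)
  finally show ?thesis unfolding m_def out_list_def rs_def ds_def by simp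
qed

section \<open>Total construction time\<close>

context convergent_params
begin

lemma build_graph_steps:
  assumes ps: "distinct ps" "set ps = P"
  shows "real (steps (build_graph \<delta> \<alpha> \<tau> ps))
    \<le> 24 * 16 powr dim * (real (card P) ^ 2 * (degree_bound dim \<alpha> \<tau> \<Delta> + log 2 (real (card P))))"
proof -
  define n where "n = length ps"
  define K where "K = 3 * 16 powr dim * degree_bound dim \<alpha> \<tau> \<Delta>"
  define l where "l = log 2 (real n)"
  define h where "h = nat \<lceil>l\<rceil>"
  have n: "card P = n" unfolding n_def using ps distinct_card by fastforce
  obtain x y where "x \<in> P" "y \<in> P" "\<delta> x y = 1" using closest_pair by blast
  then have "{x, y} \<subseteq> P" "x \<noteq> y" using P_sub by auto
  then have "card {x, y} \<le> n" "card {x, y} = 2" using finite_P n card_mono by (blast, simp)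
  then have n2: "2 \<le> n" by simp
  then have l: "1 \<le> l" unfolding l_def by (simp add: le_log_iff)
  then have h: "l \<le> real h" "real h \<le> l + 1" unfolding h_def by linarith+
  then have "real n \<le> 2 ^ h" using n2 unfolding l_def by (simp add: log_le_iff powr_realpow)
  then have nh: "length ps \<le> 2 ^ h" unfolding n_def by (simp flip: of_nat_le_iff)
  \<comment> \<open>The degree bound is applied to the very graph being built, which is already
    known to be convergent.\<close>
  interpret convergent M \<delta> P \<Delta> \<tau> \<alpha> "edges_of (val (build_graph \<delta> \<alpha> \<tau> ps))"
    using convergent_graph_build_graph[OF ps(1)] ps(2) by unfold_locales simp
  have out: "real (steps (out_list \<delta> \<alpha> \<tau> ps p) + 1) \<le> real n * (K + 6 * h + 3) + 5" if "p \<in> P" for p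
  proof -
    have "real (length (val (out_list \<delta> \<alpha> \<tau> ps p))) \<le> K"
      using out_degree_le[OF that] that ps out_list_props(2)[OF ps(1)]
      unfolding K_def edges_of_build_graph by (simp add: distinct_card)
    then have "real n * (length (val (out_list \<delta> \<alpha> \<tau> ps p)) + 6 * h + 3) \<le> real n * (K + 6 * h + 3)"
      by (intro mult_left_mono) auto
    moreover have "real (steps (out_list \<delta> \<alpha> \<tau> ps p))
        \<le> real (length ps * (length (val (out_list \<delta> \<alpha> \<tau> ps p)) + 6 * h + 3) + 4)"
      using out_list_steps[OF nh] by (rule of_nat_mono)
    ultimately show ?thesis unfolding n_def by simp
  qed
  have "real (steps (build_graph \<delta> \<alpha> \<tau> ps)) = (\<Sum>p\<in>P. real (steps (out_list \<delta> \<alpha> \<tau> ps p) + 1)) + 1"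
    using ps unfolding build_graph_def build_from_steps by (simp add: sum_list_distinct_conv_sum_set)
  also have "\<dots> \<le> (\<Sum>p\<in>P. real n * (K + 6 * h + 3) + 5) + 1"
    using out by (intro add_mono sum_mono) auto
  also have "\<dots> = real n ^ 2 * (K + 6 * h + 3) + 5 * real n + 1"
    by (simp add: n power2_eq_square algebra_simps)
  also have "\<dots> \<le> real n ^ 2 * (K + 6 * h + 3) + real n ^ 2 * 3"
  proof -
    have "2 * real n \<le> real n * real n" "2 * 2 \<le> real n * real n"
      using n2 by (intro mult_mono; simp)+
    then show ?thesis by (simp add: power2_eq_square)
  qed
  also have "\<dots> = real n ^ 2 * (K + 6 * h + 6)" by (simp add: algebra_simps)
  \<comment> \<open>Here \<open>h \<le> l + 1\<close> gives
    \<open>6 * h + 6 \<le> 6 * l + 12\<close>, and \<open>l \<ge> 1\<close> because there are at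
    least two points.\<close>
  also have "\<dots> \<le> real n ^ 2 * (K + 18 * l)" using h l by (intro mult_left_mono) auto
  also have "\<dots> \<le> real n ^ 2 * (24 * 16 powr dim * (degree_bound dim \<alpha> \<tau> \<Delta> + l))"
  proof (rule mult_left_mono)
    have "1 \<le> degree_bound dim \<alpha> \<tau> \<Delta>"
      using \<alpha>_gt_1 \<tau>_ge_1 dim_ge_1 by (intro degree_bound_ge_1) auto
    then have "K \<le> 24 * 16 powr dim * degree_bound dim \<alpha> \<tau> \<Delta>"
      unfolding K_def by (intro mult_right_mono) auto
    moreover have "18 * 1 \<le> 24 * 16 powr dim"
      using dim_ge_1 by (intro mult_mono) (auto simp: ge_one_powr_ge_zero)
    then have "18 * l \<le> 24 * 16 powr dim * l" using l by (intro mult_right_mono) auto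
    ultimately show "K + 18 * l \<le> 24 * 16 powr dim * (degree_bound dim \<alpha> \<tau> \<Delta> + l)"
      by (simp add: algebra_simps)
  qed simp
  finally show ?thesis unfolding n l_def by (simp add: mult_ac)
qed

end

section \<open>From extreme distances to the locale assumptions\<close>

lemma doubling_points_of_Min:
  assumes "Metric_space M \<delta>" "P \<subseteq> M" "finite P" "card P \<ge> 2"
    and Min: "Min {\<delta> x y | x y. x \<in> P \<and> y \<in> P \<and> x \<noteq> y} = 1"
  shows "doubling_points M \<delta> P"
proof -
  let ?A = "{\<delta> x y | x y. x \<in> P \<and> y \<in> P \<and> x \<noteq> y}"
  have fin: "finite ?A"
    by (rule finite_subset[of _ "case_prod \<delta> ` (P \<times> P)"]) (use assms(3) in auto)
  have "\<not> card P \<le> Suc 0" using assms(4) by simp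
  then obtain x y where "x \<in> P" "y \<in> P" "x \<noteq> y" using assms(3) by (auto simp: card_le_Suc0_iff_eq)
  then have "?A \<noteq> {}" by blast
  \<comment> \<open>A minimum over a finite nonempty set is attained, which supplies the closest
    pair; separation is its lower-bound property.\<close>
  from Min_in[OF fin this] have "1 \<in> ?A" unfolding Min .
  then have "\<exists>x\<in>P. \<exists>y\<in>P. \<delta> x y = 1" by fastforce
  moreover have "1 \<le> \<delta> x y" if "x \<in> P" "y \<in> P" "x \<noteq> y" for x y
  proof -
    have "Min ?A \<le> \<delta> x y" using that by (intro Min_le[OF fin]) blast
    then show ?thesis unfolding Min .
  qed
  ultimately show ?thesis
    using assms(1-3) by (intro doubling_points.intro doubling_points_axioms.intro) auto
qed

lemma convergent_params_of_Min_Max: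
  assumes "Metric_space M \<delta>" "P \<subseteq> M" "finite P" "card P \<ge> 2"
    and "Min {\<delta> x y | x y. x \<in> P \<and> y \<in> P \<and> x \<noteq> y} = 1"
    and \<Delta>: "\<Delta> = Max {\<delta> x y | x y. x \<in> P \<and> y \<in> P}"
    and "1 \<le> \<tau>" "\<tau> \<le> \<Delta>" "\<alpha> > 1"
  shows "convergent_params M \<delta> P \<Delta> \<tau> \<alpha>"
proof -
  have "finite {\<delta> x y | x y. x \<in> P \<and> y \<in> P}"
    by (rule finite_subset[of _ "case_prod \<delta> ` (P \<times> P)"]) (use assms(3) in auto)
  then have "\<delta> x y \<le> \<Delta>" if "x \<in> P" "y \<in> P" for x y
    unfolding \<Delta> using that by (intro Max_ge) auto
  then show ?thesis
    using doubling_points_of_Min[OF assms(1-5)] assms(7-9)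
    by (intro convergent_params.intro convergent_params_axioms.intro) auto
qed

text \<open>\<open>C\<close> is chosen before the space and all other parameters, so it depends on
  \<open>d\<close> only; \<open>24 * 16 powr d\<close> dominates the constants of all bounds. Ties
  make routing nondeterministic, so the claims hold for every run and the existence of a run is
  stated separately. A nearest neighbour need not be unique, hence the conditional clause for
  \<open>last hs = v\<close>. In the far case \<open>k\<close> is where routing may stop, and
  continuing preserves the guarantee.\<close>

theorem theorem3p5:
  fixes d :: real
  shows "\<exists>C>0. \<forall>(M :: 'a set) \<delta> P \<Delta> \<tau> \<alpha>.
    Metric_space M \<delta> \<and> P \<subseteq> M \<and> finite P \<and> card P \<ge> 2 \<and>
    Min {\<delta> x y | x y. x \<in> P \<and> y \<in> P \<and> x \<noteq> y} = 1 \<and>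
    Metric_space.doubling_dimension M \<delta> P = d \<and>
    \<Delta> = Max {\<delta> x y | x y. x \<in> P \<and> y \<in> P} \<and>
    1 \<le> \<tau> \<and> \<tau> \<le> \<Delta> \<and> \<alpha> > 1 \<longrightarrow>
    (\<forall>E. convergent_graph \<delta> \<alpha> \<tau> P E \<longrightarrow>
      (\<forall>q\<in>M. \<forall>v s. nearest_neighbor \<delta> P q v \<and> s \<in> P \<longrightarrow>
        (\<exists>hs. greedy_run \<delta> E q s hs) \<and>
        (\<forall>hs. greedy_run \<delta> E q s hs \<longrightarrow>
          (\<delta> q v \<le> \<tau> \<longrightarrow>
            nearest_neighbor \<delta> P q (last hs) \<and>
            ((\<forall>w. nearest_neighbor \<delta> P q w \<longrightarrow> w = v) \<longrightarrow> last hs = v) \<and>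
            real (query_time E hs) \<le> C * (degree_bound d \<alpha> \<tau> \<Delta> * log \<alpha> (max 2 \<Delta>))) \<and>
          (\<not> \<delta> q v \<le> \<tau> \<longrightarrow> (\<forall>\<epsilon>>0. \<exists>k<length hs.
            (\<forall>j. k \<le> j \<and> j < length hs \<longrightarrow>
              approx_nearest_neighbor \<delta> P ((\<alpha> + 1) / (\<alpha> - 1) + \<epsilon>) q (hs ! j)) \<and>
            real (query_time E (take (Suc k) hs))
              \<le> C * (degree_bound d \<alpha> \<tau> \<Delta> * max 1 (log \<alpha> (\<Delta> / ((\<alpha> - 1) * \<epsilon>)))))))) \<and>
      real (graph_space P E) \<le> C * (real (card P) * degree_bound d \<alpha> \<tau> \<Delta>)) \<and>
    (\<forall>ps. distinct ps \<and> set ps = P \<longrightarrow>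
      convergent_graph \<delta> \<alpha> \<tau> P (edges_of (val (build_graph \<delta> \<alpha> \<tau> ps))) \<and>
      real (steps (build_graph \<delta> \<alpha> \<tau> ps))
        \<le> C * (real (card P) ^ 2 * (degree_bound d \<alpha> \<tau> \<Delta> + log 2 (real (card P)))))"
proof (intro exI[of _ "24 * 16 powr d"] conjI allI impI, goal_cases)
  case 1
  show ?case by simp
next
  case (2 M \<delta> P \<Delta> \<tau> \<alpha> E)
  then interpret convergent M \<delta> P \<Delta> \<tau> \<alpha> E
    by (intro convergent.intro convergent_params_of_Min_Max convergent_axioms.intro)
      (elim conjE, assumption)+
  have d: "dim = d" using 2 by blast
  show ?case
  proof (intro ballI allI impI conjI; (elim conjE)?)
    fix q v s assume "s \<in> P"
    moreover have "E \<subseteq> P \<times> P" using graph unfolding convergent_graph_def by blast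
    ultimately show "\<exists>hs. greedy_run \<delta> E q s hs" using finite_P by (intro greedy_run_exists)
  next
    fix q v s hs
    assume "q \<in> M" "nearest_neighbor \<delta> P q v" "s \<in> P" "greedy_run \<delta> E q s hs"
    then interpret greedy_query M \<delta> P \<Delta> \<tau> \<alpha> E q v s hs by unfold_locales
    {
      assume near: "\<delta> q v \<le> \<tau>"
      show "nearest_neighbor \<delta> P q (last hs)" using last_nearest[OF near] .
      then show "last hs = v" if "\<forall>w. nearest_neighbor \<delta> P q w \<longrightarrow> w = v" using that by blast
      show "real (query_time E hs) \<le> 24 * 16 powr d * (degree_bound d \<alpha> \<tau> \<Delta> * log \<alpha> (max 2 \<Delta>))"
        using query_time_exact[OF near] unfolding d .
    next
      fix \<epsilon> :: real
      assume "\<not> \<delta> q v \<le> \<tau>" "\<epsilon> > 0"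
      then show "\<exists>k<length hs.
          (\<forall>j. k \<le> j \<and> j < length hs \<longrightarrow>
            approx_nearest_neighbor \<delta> P ((\<alpha> + 1) / (\<alpha> - 1) + \<epsilon>) q (hs ! j)) \<and>
          real (query_time E (take (Suc k) hs))
            \<le> 24 * 16 powr d * (degree_bound d \<alpha> \<tau> \<Delta> * max 1 (log \<alpha> (\<Delta> / ((\<alpha> - 1) * \<epsilon>))))"
        using query_time_approx unfolding d by blast
    }
  qed
next
  case (3 M \<delta> P \<Delta> \<tau> \<alpha> E)
  then interpret convergent M \<delta> P \<Delta> \<tau> \<alpha> E
    by (intro convergent.intro convergent_params_of_Min_Max convergent_axioms.intro)
      (elim conjE, assumption)+
  have "dim = d" using 3 by blast
  moreover have "4 * 16 powr dim * (real (card P) * degree_bound dim \<alpha> \<tau> \<Delta>)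
      \<le> 24 * 16 powr dim * (real (card P) * degree_bound dim \<alpha> \<tau> \<Delta>)"
    using degree_bound_ge_1[of \<alpha> \<tau> dim \<Delta>] \<alpha>_gt_1 \<tau>_ge_1 dim_ge_1 by (intro mult_right_mono) auto
  ultimately show ?case using graph_space_le by simp
next
  case (4 M \<delta> P \<Delta> \<tau> \<alpha> ps)
  then show ?case using convergent_graph_build_graph by blast
next
  case (5 M \<delta> P \<Delta> \<tau> \<alpha> ps)
  then interpret convergent_params M \<delta> P \<Delta> \<tau> \<alpha>
    by (intro convergent_params_of_Min_Max) (elim conjE, assumption)+
  have "dim = d" using 5 by blast
  moreover have "distinct ps" "set ps = P" using 5 by blast+
  ultimately show ?case using build_graph_steps[of ps] by simp
qed

end
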